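(* The filter equations for a rigid body with the attitude kinematics $\dot R=R\Omega^\times$ ($R\in SO(3)$, $\Omega\in\mathbb R^3$) and with measurements $U^m$ of vectors and $\Omega^m$ of angular velocity in a body-fixed frame, are of the form $$\begin{cases}\dot{\hat R}=\hat R\hat\Omega^\times=\hat R(\Omega^m-\omega-\hat\beta)^\times,\\ m\dot\omega=-m\hat\Omega\times\omega+\Phi'\big(\mathcal U^0(\hat R,U^m)\big)S_L(\hat R)-D\omega,\\ \hat\Omega=\Omega^m-\omega-\hat\beta,\end{cases}$$ where $\hat R(t_0)=\hat R_0$, $\omega(t_0)=\omega_0=\Omega^m_0-\hat\Omega_0-\hat\beta_0$, $S_L(\hat R)=\mathrm{vex}(L^T\hat R-\hat R^TL)\in\mathbb R^3$, $L=EW(U^m)^T$, and $W$ is chosen to satisfy the conditions given in the context.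
   Context: $a^\times$ is the skew-symmetric matrix with $a^\times c=a\times c$; $\mathrm{vex}$ is the inverse of $a\mapsto a^\times$; $\langle A_1,A_2\rangle=\mathrm{trace}(A_1^TA_2)$. Measurement models: $U^m=R^TE+N$ with $N$ additive noise, and $\Omega^m=\Omega+w+\beta$ with $w$ the measurement error and $\beta\in\mathbb R^3$ a bias vector, considered constant. $E\in\mathbb R^{3\times n}$ (rank 3) has the known inertial vectors as columns (with the cross product as a third column when only two vectors are measured). $\hat R\in SO(3)$, $\hat\Omega,\hat\beta\in\mathbb R^3$ are the estimated attitude, angular velocity and bias; $\omega:=\Omega^m-\hat\Omega-\hat\beta$ is the angular velocity measurement residual. $m>0$ is a scalar, $D\in\mathbb R^{3\times3}$ is a positive definite filter gain matrix. $\mathcal U^0(\hat R,U^m)=\frac12\langle E-\hat RU^m,(E-\hat RU^m)W\rangle$. $\Phi:[0,\infty)\to[0,\infty)$ is a $C^2$ function with $\Phi(0)=0$ and $\Phi'(x)>0$ for all $x\in[0,\infty)$; furthermore $\Phi'(\cdot)\le\alpha(\cdot)$ where $\alpha(\cdot)$ is a Class-$\mathcal K$ function. Conditions on the positive definite matrix $W$: $W=V_EW_0V_E^T$, where $E=U_E\Sigma_EV_E^T$ is a singular value decomposition with singular values $\sigma_1,\sigma_2,\sigma_3$, and $W_0$ is diagonal with positive diagonal entries, the first three being $d_i/\sigma_i^2$ with $d_1,d_2,d_3>0$ distinct. "The filter" here is the attitude and angular velocity filtering scheme to which one is led by applying the Lagrange-d'Alembert principle to the action functional $\int_{t_0}^T\{\frac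 m2(\Omega^m-\hat\Omega-\hat\beta)^T(\Omega^m-\hat\Omega-\hat\beta)-\Phi(\mathcal U^0(\hat R,U^m))\}\,ds$ in the presence of the dissipation term $\tau_D=D\omega$, linear in $\omega$. *)

theory Defs
  imports "HOL-Analysis.Analysis"
begin

unbundle no cross3_syntax
unbundle set_product_syntax

definition skew :: "real^3 \<Rightarrow> real^3^3" where
  "skew a = matrix (cross3 a)"

text \<open>Inverse of \<^const>\<open>skew\<close>; only meaningful on skew-symmetric matrices.\<close>

definition vex :: "real^3^3 \<Rightarrow> real^3" where
  "vex = inv skew"

definition frob_inner :: "real^'n^3 \<Rightarrow> real^'n^3 \<Rightarrow> real" where
  "frob_inner A B = trace (transpose A ** B)"

text \<open>Symmetry is not part of this definition. A weight satisfying \<open>weight_condition\<close> below is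
  symmetric by construction; for the gain \<open>D\<close> symmetry is not required.\<close>

definition pos_def_matrix :: "real^'n^'n \<Rightarrow> bool" where
  "pos_def_matrix A \<longleftrightarrow> (\<forall>x. x \<noteq> 0 \<longrightarrow> 0 < x \<bullet> (A *v x))"

text \<open>Matrix dimensions are unordered finite types, so an injection \<open>\<iota> :: 3 \<Rightarrow> 'n\<close> says which three
  of the \<open>n\<close> indices are the first ones: \<open>\<sigma> i\<close> is at position \<open>(i, \<iota> i)\<close> of the rectangular
  diagonal factor.\<close>

definition is_svd ::
  "(3 \<Rightarrow> 'n) \<Rightarrow> real^'n^3 \<Rightarrow> real^3^3 \<Rightarrow> (3 \<Rightarrow> real) \<Rightarrow> real^'n^'n \<Rightarrow> bool" where
  "is_svd \<iota> E U \<sigma> V \<longleftrightarrow>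
     inj \<iota> \<and> orthogonal_matrix U \<and> orthogonal_matrix V \<and> (\<forall>i. 0 \<le> \<sigma> i) \<and>
     E = U ** (\<chi> i j. if j = \<iota> i then \<sigma> i else 0) ** transpose V"

definition weight_condition :: "real^'n^3 \<Rightarrow> real^'n^'n \<Rightarrow> bool" where
  "weight_condition E W \<longleftrightarrow>
     (\<exists>\<iota> U \<sigma> V (w :: 'n \<Rightarrow> real) (d :: 3 \<Rightarrow> real).
        is_svd \<iota> E U \<sigma> V \<and> (\<forall>j. 0 < w j) \<and> (\<forall>i. 0 < d i) \<and> inj d \<and>
        (\<forall>i. w (\<iota> i) = d i / (\<sigma> i)\<^sup>2) \<and>
        W = V ** (\<chi> i j. if i = j then w i else 0) ** transpose V)"

text \<open>\<open>\<Phi>\<close> is a \<open>C\<^sup>2\<close> map of \<open>[0,\<infinity>)\<close> into itself with \<open>\<Phi> 0 = 0\<close> and first derivative \<open>\<Phi>'\<close> (one-sided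
  at 0). In the source one has \<open>\<Phi>' > 0\<close> on all of \<open>[0,\<infinity>)\<close> together with \<open>\<Phi>' \<le> \<alpha>\<close> for a class-K
  function \<open>\<alpha>\<close>. As \<open>\<alpha> 0 = 0\<close>, these two contradict each other at 0, and imposing both would make
  everything below vacuous. The bound by \<open>\<alpha>\<close> is therefore omitted, and positivity is required
  only on \<open>(0,\<infinity>)\<close>: this is implied both by strict positivity on \<open>[0,\<infinity>)\<close> (e.g. \<open>\<Phi> x = x\<close>)
  and by positivity on \<open>(0,\<infinity>)\<close> together with the bound (e.g. \<open>\<Phi> x = x\<^sup>2\<close>).\<close>

definition potential_shape :: "(real \<Rightarrow> real) \<Rightarrow> (real \<Rightarrow> real) \<Rightarrow> bool" where
  "potential_shape \<Phi> \<Phi>' \<longleftrightarrow>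
     (\<forall>x\<ge>0. 0 \<le> \<Phi> x) \<and> \<Phi> 0 = 0 \<and>
     (\<forall>x\<ge>0. (\<Phi> has_real_derivative \<Phi>' x) (at x within {0..})) \<and>
     (\<exists>\<Phi>''. (\<forall>x\<ge>0. (\<Phi>' has_real_derivative \<Phi>'' x) (at x within {0..})) \<and>
            continuous_on {0..} \<Phi>'') \<and>
     (\<forall>x>0. 0 < \<Phi>' x)"

definition U0 :: "real^'n^3 \<Rightarrow> real^'n^'n \<Rightarrow> real^3^3 \<Rightarrow> real^'n^3 \<Rightarrow> real" where
  "U0 E W Rh Um = 1/2 * frob_inner (E - Rh ** Um) ((E - Rh ** Um) ** W)"

definition S_L :: "real^3^3 \<Rightarrow> real^3^3 \<Rightarrow> real^3" where
  "S_L L Rh = vex (transpose L ** Rh - transpose Rh ** L)"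

definition action ::
  "real \<Rightarrow> (real \<Rightarrow> real) \<Rightarrow> real^'n^3 \<Rightarrow> real^'n^'n \<Rightarrow>
   (real \<Rightarrow> real^'n^3) \<Rightarrow> (real \<Rightarrow> real^3) \<Rightarrow> (real \<Rightarrow> real^3) \<Rightarrow> real \<Rightarrow> real \<Rightarrow>
   (real \<Rightarrow> real^3^3) \<Rightarrow> (real \<Rightarrow> real^3) \<Rightarrow> real" where
  "action m \<Phi> E W Um \<Omega>m \<beta>h t0 T Rh \<Omega>h =
     integral {t0..T} (\<lambda>s.
       m / 2 * ((\<Omega>m s - \<Omega>h s - \<beta>h s) \<bullet> (\<Omega>m s - \<Omega>h s - \<beta>h s)) - \<Phi> (U0 E W (Rh s) (Um s)))"

definition attitude_curve ::
  "real \<Rightarrow> real \<Rightarrow> (real \<Rightarrow> real^3^3) \<Rightarrow> (real \<Rightarrow> real^3) \<Rightarrow> bool" where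
  "attitude_curve t0 T R \<Omega> \<longleftrightarrow>
     (\<forall>t\<in>{t0..T}. rotation_matrix (R t) \<and>
        (R has_vector_derivative R t ** skew (\<Omega> t)) (at t within {t0..T})) \<and>
     continuous_on {t0..T} \<Omega>"

text \<open>A family \<open>\<epsilon> \<mapsto> (Rv \<epsilon>, \<Omega>v \<epsilon>)\<close> of curves on SO(3) with their body velocities, with fixed
  endpoints, passing through \<open>Rh\<close> at \<open>\<epsilon> = 0\<close>, and \<open>C\<^sup>1\<close> in \<open>\<epsilon>\<close>. The body velocity
  \<open>\<Omega>v 0\<close> is that of \<open>Rh\<close> because the kinematics determine it. \<open>\<Sigma>\<close> is the reduced (body frame) virtual
  displacement, \<open>\<delta>Rh = Rh \<Sigma>\<^sup>\<times>\<close>; it vanishes at the endpoints, and the relation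
  \<open>\<delta>\<Omega> = \<Sigma>' + \<Omega> \<times> \<Sigma>\<close> is a consequence of the definition.\<close>

definition attitude_variation ::
  "real \<Rightarrow> real \<Rightarrow> (real \<Rightarrow> real^3^3) \<Rightarrow>
   (real \<Rightarrow> real \<Rightarrow> real^3^3) \<Rightarrow> (real \<Rightarrow> real \<Rightarrow> real^3) \<Rightarrow> (real \<Rightarrow> real^3) \<Rightarrow> bool" where
  "attitude_variation t0 T Rh Rv \<Omega>v \<Sigma> \<longleftrightarrow>
     (\<forall>t\<in>{t0..T}. Rv 0 t = Rh t) \<and>
     (\<forall>t\<in>{t0..T}. ((\<lambda>\<epsilon>. Rv \<epsilon> t) has_vector_derivative Rh t ** skew (\<Sigma> t)) (at 0)) \<and>
     (\<exists>r>0. \<exists>dR d\<Omega>.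
        (\<forall>\<epsilon>\<in>{-r<..<r}. attitude_curve t0 T (Rv \<epsilon>) (\<Omega>v \<epsilon>) \<and>
           Rv \<epsilon> t0 = Rh t0 \<and> Rv \<epsilon> T = Rh T) \<and>
        (\<forall>\<epsilon>\<in>{-r<..<r}. \<forall>t\<in>{t0..T}.
           ((\<lambda>e. Rv e t) has_vector_derivative dR \<epsilon> t) (at \<epsilon>) \<and>
           ((\<lambda>e. \<Omega>v e t) has_vector_derivative d\<Omega> \<epsilon> t) (at \<epsilon>)) \<and>
        continuous_on ({-r<..<r} \<times> {t0..T}) (\<lambda>(\<epsilon>, t). Rv \<epsilon> t) \<and>
        continuous_on ({-r<..<r} \<times> {t0..T}) (\<lambda>(\<epsilon>, t). \<Omega>v \<epsilon> t) \<and>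
        continuous_on ({-r<..<r} \<times> {t0..T}) (\<lambda>(\<epsilon>, t). dR \<epsilon> t) \<and>
        continuous_on ({-r<..<r} \<times> {t0..T}) (\<lambda>(\<epsilon>, t). d\<Omega> \<epsilon> t))"

text \<open>For every variation the first variation of the action plus the virtual work of
  \<open>\<tau>\<^sub>D = D (\<Omega>m - \<Omega>h - \<beta>h)\<close> vanishes. The signals \<open>Um\<close>, \<open>\<Omega>m\<close> and the bias estimate \<open>\<beta>h\<close>
  are not varied.\<close>

definition lagrange_dalembert ::
  "real \<Rightarrow> real^3^3 \<Rightarrow> (real \<Rightarrow> real) \<Rightarrow> real^'n^3 \<Rightarrow> real^'n^'n \<Rightarrow>
   (real \<Rightarrow> real^'n^3) \<Rightarrow> (real \<Rightarrow> real^3) \<Rightarrow> (real \<Rightarrow> real^3) \<Rightarrow> real \<Rightarrow> real \<Rightarrow>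
   (real \<Rightarrow> real^3^3) \<Rightarrow> (real \<Rightarrow> real^3) \<Rightarrow> bool" where
  "lagrange_dalembert m D \<Phi> E W Um \<Omega>m \<beta>h t0 T Rh \<Omega>h \<longleftrightarrow>
     attitude_curve t0 T Rh \<Omega>h \<and>
     (\<forall>Rv \<Omega>v \<Sigma>. attitude_variation t0 T Rh Rv \<Omega>v \<Sigma> \<longrightarrow>
        (\<exists>\<delta>S. ((\<lambda>\<epsilon>. action m \<Phi> E W Um \<Omega>m \<beta>h t0 T (Rv \<epsilon>) (\<Omega>v \<epsilon>)) has_real_derivative \<delta>S) (at 0) \<and>
           \<delta>S + integral {t0..T} (\<lambda>s. (D *v (\<Omega>m s - \<Omega>h s - \<beta>h s)) \<bullet> \<Sigma> s) = 0))"

end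

theory Submission
  imports Defs
begin

text \<open>Write \<open>\<Sigma>\<close> for the body-frame virtual displacement. Equality of mixed derivatives of a family of
  curves with body velocities gives \<open>\<delta>\<Omega> = \<Sigma>' + \<Omega> \<times> \<Sigma>\<close>, and since \<open>W\<close> is symmetric,
  \<open>\<delta>U\<^sup>0 = S\<^sub>L \<bullet> \<Sigma>\<close>. The virtual work principle therefore reads
  \<open>\<integral> q \<bullet> \<Sigma> - m \<omega> \<bullet> \<Sigma>' = 0\<close> with \<open>q = m \<Omega> \<times> \<omega> - \<Phi>' S\<^sub>L + D \<omega>\<close>.
  If \<open>m \<omega>' = - q\<close>, the integrand is the derivative of \<open>- m \<omega> \<bullet> \<Sigma>\<close>, which vanishes at the endpoints.
  Conversely \<open>\<omega>\<close> is a priori only continuous, so the equation comes from the du Bois-Reymond lemma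
  rather than from an integration by parts; variations rotating about a fixed axis \<open>e\<close> by the angle
  \<open>\<epsilon> f(t)\<close> have \<open>\<Sigma> = f e\<close> and suffice.\<close>

section \<open>Matrices as bilinear operations\<close>

lemma bounded_bilinear_matrix_mult:
  "bounded_bilinear ((**) :: real^'n^'m \<Rightarrow> real^'k^'n \<Rightarrow> real^'k^'m)"
proof -
  have "bilinear ((**) :: real^'n^'m \<Rightarrow> real^'k^'n \<Rightarrow> real^'k^'m)"
    unfolding bilinear_def
    by (auto intro!: linearI simp: vec_eq_iff matrix_matrix_mult_def algebra_simps sum.distrib sum_distrib_left)
  then show ?thesis
    by (simp add: bilinear_conv_bounded_bilinear)
qed

lemma bounded_bilinear_matrix_vector_mult:
  "bounded_bilinear ((*v) :: real^'n^'m \<Rightarrow> real^'n \<Rightarrow> real^'m)"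
proof -
  have "bilinear ((*v) :: real^'n^'m \<Rightarrow> real^'n \<Rightarrow> real^'m)"
    unfolding bilinear_def
    by (auto intro!: linearI simp: vec_eq_iff matrix_vector_mult_def algebra_simps sum.distrib sum_distrib_left)
  then show ?thesis
    by (simp add: bilinear_conv_bounded_bilinear)
qed

lemma bounded_linear_transpose: "bounded_linear (transpose :: real^'n^'m \<Rightarrow> real^'m^'n)"
  by (intro linear_conv_bounded_linear[THEN iffD1] linearI) (auto simp: vec_eq_iff transpose_def)

interpretation matrix_mult: bounded_bilinear "(**) :: real^'n^'m \<Rightarrow> real^'k^'n \<Rightarrow> real^'k^'m"
  by (rule bounded_bilinear_matrix_mult)

lemmas continuous_on_matrix_mult = bounded_bilinear.continuous_on[OF bounded_bilinear_matrix_mult]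
lemmas continuous_on_matrix_vector_mult = bounded_bilinear.continuous_on[OF bounded_bilinear_matrix_vector_mult]
lemmas continuous_on_transpose = bounded_linear.continuous_on[OF bounded_linear_transpose]

section \<open>Skew-symmetric matrices\<close>

lemma skew_nth [simp]:
  "skew a $ 1 $ 1 = 0" "skew a $ 1 $ 2 = - (a $ 3)" "skew a $ 1 $ 3 = a $ 2"
  "skew a $ 2 $ 1 = a $ 3" "skew a $ 2 $ 2 = 0" "skew a $ 2 $ 3 = - (a $ 1)"
  "skew a $ 3 $ 1 = - (a $ 2)" "skew a $ 3 $ 2 = a $ 1" "skew a $ 3 $ 3 = 0"
  by (simp_all add: skew_def matrix_def cross3_def axis_def)

lemma bounded_linear_skew: "bounded_linear skew"
  by (intro linear_conv_bounded_linear[THEN iffD1] linearI) (simp_all add: vec_eq_iff forall_3)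

lemmas continuous_on_skew = bounded_linear.continuous_on[OF bounded_linear_skew]

lemma skew_0 [simp]: "skew 0 = 0"
  and skew_add: "skew (a + b) = skew a + skew b"
  and skew_diff: "skew (a - b) = skew a - skew b"
  and skew_scaleR: "skew (c *\<^sub>R a) = c *\<^sub>R skew a"
  by (simp_all add: vec_eq_iff forall_3)

lemma skew_mult_vector: "skew a *v b = cross3 a b"
  by (simp add: vec_eq_iff forall_3 matrix_vector_mult_def sum_3 cross3_def)

lemma inj_skew: "inj skew"
  by (rule injI) (simp add: vec_eq_iff forall_3)

lemma skew_eq_iff [simp]: "skew a = skew b \<longleftrightarrow> a = b"
  using inj_skew by (auto dest: injD)

lemma transpose_skew: "transpose (skew a) = - skew a"
  by (simp add: vec_eq_iff forall_3 transpose_def)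

text \<open>The Lie algebra of SO(3) is the space of 3-vectors with the cross product. This turns
  the commutator that arises when \<open>dR 0\<close> is differentiated in time into
  \<open>cross3 (\<Omega>h t) (\<Sigma> t)\<close>.\<close>

lemma skew_cross: "skew (cross3 a b) = skew a ** skew b - skew b ** skew a"
  by (simp add: vec_eq_iff forall_3 matrix_matrix_mult_def sum_3 cross3_def algebra_simps)

text \<open>Since \<open>skew\<close> is not surjective, \<open>inv skew\<close> can be evaluated
  only at a matrix exhibited as a value of \<open>skew\<close>. The coordinates obtained here are
  the only access to \<open>vex\<close> below.\<close>

lemma vex_diff_transpose:
  "vex (transpose A - A) = vector [A $ 2 $ 3 - A $ 3 $ 2, A $ 3 $ 1 - A $ 1 $ 3, A $ 1 $ 2 - A $ 2 $ 1]"
proof -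
  have "transpose A - A = skew (vector [A $ 2 $ 3 - A $ 3 $ 2, A $ 3 $ 1 - A $ 1 $ 3, A $ 1 $ 2 - A $ 2 $ 1])"
    by (simp add: vec_eq_iff forall_3 transpose_def)
  then show ?thesis
    by (simp add: vex_def inj_skew)
qed

text \<open>Pairing with \<open>skew s\<close> sees only the antisymmetric part of A. Each
  off-diagonal pair of entries is met once through its difference, so no factor 2 or 1/2
  appears.\<close>

lemma inner_vex_diff_transpose: "vex (transpose A - A) \<bullet> s = - (skew s \<bullet> A)"
  by (simp add: vex_diff_transpose inner_vec_def sum_3 algebra_simps)

section \<open>The Frobenius inner product and adjoints of matrix multiplication\<close>

lemma frob_inner_eq_inner: "frob_inner A B = A \<bullet> B"
  unfolding frob_inner_def trace_def matrix_matrix_mult_def transpose_def inner_vec_def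
  by (simp, rule sum.swap)

lemma inner_matrix_mult_right:
  fixes A :: "real^'k^'m" and B :: "real^'n^'m" and C :: "real^'k^'n"
  shows "A \<bullet> (B ** C) = (A ** transpose C) \<bullet> B"
proof -
  have "A \<bullet> (B ** C) = (\<Sum>i\<in>UNIV. \<Sum>k\<in>UNIV. \<Sum>j\<in>UNIV. A $ i $ k * (B $ i $ j * C $ j $ k))"
    by (simp add: inner_vec_def matrix_matrix_mult_def sum_distrib_left)
  also have "\<dots> = (\<Sum>i\<in>UNIV. \<Sum>j\<in>UNIV. \<Sum>k\<in>UNIV. A $ i $ k * (B $ i $ j * C $ j $ k))"
    by (intro sum.cong refl sum.swap)
  also have "\<dots> = (A ** transpose C) \<bullet> B"
    by (simp add: inner_vec_def matrix_matrix_mult_def transpose_def sum_distrib_left sum_distrib_right mult_ac)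
  finally show ?thesis .
qed

lemma inner_transpose: "transpose A \<bullet> transpose B = A \<bullet> (B :: real^'n^'m)"
  unfolding inner_vec_def transpose_def by (simp, rule sum.swap)

text \<open>Transposing both factors preserves the inner product, yet it negates
  \<open>skew s\<close> and fixes A; so the product equals its own negative.\<close>

lemma skew_inner_symmetric: "transpose A = A \<Longrightarrow> skew s \<bullet> A = 0"
  using inner_transpose[of "skew s" A] by (simp add: transpose_skew)

lemma inner_matrix_mult_left:
  fixes A :: "real^'k^'m" and B :: "real^'n^'m" and C :: "real^'k^'n"
  shows "A \<bullet> (B ** C) = (transpose B ** A) \<bullet> C"
proof -
  have "A \<bullet> (B ** C) = transpose A \<bullet> (transpose C ** transpose B)"
    by (simp only: inner_transpose matrix_transpose_mul[symmetric])
  also have "\<dots> = transpose (transpose B ** A) \<bullet> transpose C"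
    by (simp only: inner_matrix_mult_right matrix_transpose_mul transpose_transpose)
  finally show ?thesis by (simp only: inner_transpose)
qed

text \<open>\<open>pos_def_matrix\<close> says nothing about symmetry, and the gradient of the
  potential relies on it. It is read off from the form V diag(w) V^T of the weight.\<close>

lemma weight_condition_symmetric:
  fixes E :: "real^'n^3" and W :: "real^'n^'n"
  assumes "weight_condition E W"
  shows "transpose W = W"
proof -
  obtain V :: "real^'n^'n" and w :: "'n \<Rightarrow> real" where W: "W = V ** (\<chi> i j. if i = j then w i else 0) ** transpose V"
    using assms unfolding weight_condition_def by blast
  have "transpose (\<chi> i j. if i = j then w i else 0) = (\<chi> i j. if i = j then w i else (0::real))"
    by (simp add: vec_eq_iff transpose_def)
  then show ?thesis
    by (simp add: W matrix_transpose_mul matrix_mul_assoc)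
qed

section \<open>The potential and its gradient\<close>

text \<open>The function \<Phi> is controlled only on the nonnegative reals, so its argument must be
  shown to lie there. The weighted square of M is the sum over the rows of M of the quadratic form
  of W.\<close>

lemma U0_nonneg:
  fixes E :: "real^'n^3" and W :: "real^'n^'n"
  assumes "pos_def_matrix W"
  shows "0 \<le> U0 E W A U"
proof -
  have *: "0 \<le> x \<bullet> (W *v x)" for x
    using assms unfolding pos_def_matrix_def by (cases "x = 0") (auto intro: less_imp_le)
  have "0 \<le> M \<bullet> (M ** W)" for M :: "real^'n^3"
  proof -
    have "M \<bullet> (M ** W) = (\<Sum>i\<in>UNIV. (M $ i) \<bullet> (W *v (M $ i)))"
      unfolding inner_vec_def[of M]
    proof (intro sum.cong refl)
      fix i
      have "(M ** W) $ i = M $ i v* W"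
        by (simp add: vec_eq_iff matrix_matrix_mult_def vector_matrix_mult_def mult.commute)
      then show "M $ i \<bullet> (M ** W) $ i = M $ i \<bullet> (W *v (M $ i))"
        by (metis dot_lmul_matrix inner_commute)
    qed
    with * show ?thesis by (simp add: sum_nonneg)
  qed
  then show ?thesis by (simp add: U0_def frob_inner_eq_inner)
qed

text \<open>For symmetric W this is the directional derivative of \<open>U0\<close> in the attitude
  argument. The direction H is an arbitrary matrix, because away from \<open>\<epsilon> = 0\<close>
  the derivative \<open>dR\<close> of a variation is not given in the form attitude times skew
  matrix.\<close>

definition dU0 :: "real^'n^3 \<Rightarrow> real^'n^'n \<Rightarrow> real^3^3 \<Rightarrow> real^'n^3 \<Rightarrow> real^3^3 \<Rightarrow> real" where
  "dU0 E W A U H = - ((H ** U) \<bullet> ((E - A ** U) ** W))"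

text \<open>The product rule yields two terms; symmetry of W makes them equal, which cancels the
  factor 1/2.\<close>

lemma U0_has_vector_derivative:
  assumes "transpose W = W" and "(\<rho> has_vector_derivative H) (at x)"
  shows "((\<lambda>x. U0 E W (\<rho> x) U) has_vector_derivative dU0 E W (\<rho> x) U H) (at x)"
proof -
  have a: "((\<lambda>x. E - \<rho> x ** U) has_vector_derivative - (H ** U)) (at x)"
    by (auto intro!: derivative_eq_intros bounded_linear.has_vector_derivative[OF matrix_mult.bounded_linear_left] assms(2))
  then have "((\<lambda>x. (E - \<rho> x ** U) ** W) has_vector_derivative - (H ** U) ** W) (at x)"
    by (rule bounded_linear.has_vector_derivative[OF matrix_mult.bounded_linear_left])
  with a have "((\<lambda>x. (E - \<rho> x ** U) \<bullet> ((E - \<rho> x ** U) ** W)) has_vector_derivative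
      (E - \<rho> x ** U) \<bullet> (- (H ** U) ** W) + (- (H ** U)) \<bullet> ((E - \<rho> x ** U) ** W)) (at x)"
    by (rule bounded_bilinear.has_vector_derivative[OF bounded_bilinear_inner])
  then have "((\<lambda>x. (1/2) *\<^sub>R ((E - \<rho> x ** U) \<bullet> ((E - \<rho> x ** U) ** W))) has_vector_derivative
      (1/2) *\<^sub>R ((E - \<rho> x ** U) \<bullet> (- (H ** U) ** W) + (- (H ** U)) \<bullet> ((E - \<rho> x ** U) ** W))) (at x)"
    by (rule bounded_linear.has_vector_derivative[OF bounded_linear_scaleR_right])
  moreover have "(E - \<rho> x ** U) \<bullet> (- (H ** U) ** W) = (- (H ** U)) \<bullet> ((E - \<rho> x ** U) ** W)"
    using inner_matrix_mult_right[of "E - \<rho> x ** U" "- (H ** U)" W]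
    by (simp only: assms(1) inner_commute[of "- (H ** U)"])
  ultimately show ?thesis
    by (simp add: U0_def frob_inner_eq_inner dU0_def)
qed

text \<open>Thus \<open>S_L\<close> is the body-frame gradient of the potential on SO(3). Moving A
  and U across the inner product leaves \<open>skew s\<close> paired with A^T L - U W U^T. The
  second matrix is symmetric, hence orthogonal to \<open>skew s\<close>, and the first contributes
  only its antisymmetric part.\<close>

lemma dU0_body:
  assumes W: "transpose W = W" and A: "rotation_matrix A"
  shows "dU0 E W A U (A ** skew s) = S_L (E ** W ** transpose U) A \<bullet> s"
proof -
  let ?L = "E ** W ** transpose U"
  have AA: "transpose A ** A = mat 1"
    using A by (simp add: rotation_matrix_def orthogonal_matrix)
  have sym: "transpose (U ** W ** transpose U) = U ** W ** transpose U"
    by (simp add: matrix_transpose_mul W matrix_mul_assoc)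
  let ?X = "(E - A ** U) ** W"
  have "(A ** skew s ** U) \<bullet> ?X = (?X ** transpose U) \<bullet> (A ** skew s)"
    by (subst inner_commute) (rule inner_matrix_mult_right)
  also have "\<dots> = skew s \<bullet> (transpose A ** (?X ** transpose U))"
    by (subst inner_matrix_mult_left) (rule inner_commute)
  also have "transpose A ** (((E - A ** U) ** W) ** transpose U) =
      transpose A ** ?L - (transpose A ** A) ** (U ** W ** transpose U)"
    by (simp add: matrix_mult.diff_left matrix_mult.diff_right matrix_mul_assoc)
  also have "skew s \<bullet> \<dots> = skew s \<bullet> (transpose A ** ?L)"
    by (simp add: AA inner_diff_right skew_inner_symmetric[OF sym])
  finally show ?thesis
    using inner_vex_diff_transpose[of "transpose A ** ?L" s]
    by (simp add: dU0_def S_L_def matrix_transpose_mul)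
qed

text \<open>Nothing is known about \<open>vex\<close> off the range of \<open>skew\<close>, so the
  bounded linear map used is the composite of \<open>vex\<close> with A^T - A.\<close>

lemma continuous_on_S_L:
  assumes "continuous_on X L" "continuous_on X A"
  shows "continuous_on X (\<lambda>t. S_L (L t) (A t))"
proof -
  have "bounded_linear (\<lambda>A. vex (transpose A - A))"
    by (intro linear_conv_bounded_linear[THEN iffD1] linearI)
      (simp_all add: vex_diff_transpose vec_eq_iff forall_3 algebra_simps)
  moreover have "continuous_on X (\<lambda>t. transpose (A t) ** L t)"
    by (intro continuous_on_matrix_mult continuous_on_transpose assms)
  ultimately show ?thesis
    unfolding S_L_def
    by (auto dest: bounded_linear.continuous_on simp: matrix_transpose_mul)
qed

lemma orthogonal_matrix_cancel:
  "orthogonal_matrix A \<Longrightarrow> A ** B = A ** C \<Longrightarrow> B = (C :: real^'k^'n)"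
  by (metis matrix_mul_assoc matrix_mul_lid orthogonal_matrix)

section \<open>Variations of attitude curves\<close>

text \<open>Derivatives within a nondegenerate closed interval are unique, and an orthogonal factor
  cancels. A variation prescribes only \<open>Rv 0\<close>; this lemma then identifies
  \<open>\<Omega>v 0\<close> with \<open>\<Omega>h\<close>.\<close>

lemma attitude_curve_velocity_unique:
  assumes "t0 < T" "attitude_curve t0 T R \<Omega>" "attitude_curve t0 T S \<Xi>"
    and "\<forall>t\<in>{t0..T}. S t = R t" and "t \<in> {t0..T}"
  shows "\<Xi> t = \<Omega> t"
proof -
  have "(R has_vector_derivative R t ** skew (\<Omega> t)) (at t within {t0..T})"
    and 1: "(S has_vector_derivative S t ** skew (\<Xi> t)) (at t within {t0..T})"
    and 2: "orthogonal_matrix (R t)"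
    using assms unfolding attitude_curve_def rotation_matrix_def by auto
  moreover have "(R has_vector_derivative S t ** skew (\<Xi> t)) (at t within {t0..T})"
    by (rule has_vector_derivative_transform[OF assms(5) _ 1]) (simp add: assms(4))
  ultimately have "R t ** skew (\<Omega> t) = S t ** skew (\<Xi> t)"
    using assms by (intro vector_derivative_unique_within_closed_interval[of t0 T t R]) (auto simp: cbox_interval)
  then show ?thesis
    using orthogonal_matrix_cancel[OF 2] assms(4,5) by fastforce
qed

text \<open>The curve \<open>\<Sigma>\<close> is given pointwise in t through a derivative in
  \<epsilon>, so its differentiability in t has to be proved. The integrated kinematics present
  \<open>dR 0\<close> as an indefinite integral, and the skew matrix of \<open>\<Sigma> t\<close> is
  the transpose of \<open>Rh t\<close> times \<open>dR 0 t\<close>, to which the product rule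
  applies.\<close>

lemma attitude_variation_reduced:
  assumes "t0 < T" and c: "attitude_curve t0 T Rh \<Omega>h"
    and v: "attitude_variation t0 T Rh Rv \<Omega>v \<Sigma>"
  obtains r dR d\<Omega> where "0 < r"
    and "\<And>\<epsilon> t. \<epsilon> \<in> {-r<..<r} \<Longrightarrow> t \<in> {t0..T} \<Longrightarrow> ((\<lambda>e. Rv e t) has_vector_derivative dR \<epsilon> t) (at \<epsilon>)"
    and "\<And>\<epsilon> t. \<epsilon> \<in> {-r<..<r} \<Longrightarrow> t \<in> {t0..T} \<Longrightarrow> ((\<lambda>e. \<Omega>v e t) has_vector_derivative d\<Omega> \<epsilon> t) (at \<epsilon>)"
    and "continuous_on ({-r<..<r} \<times> {t0..T}) (\<lambda>(\<epsilon>, t). Rv \<epsilon> t)"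
    and "continuous_on ({-r<..<r} \<times> {t0..T}) (\<lambda>(\<epsilon>, t). \<Omega>v \<epsilon> t)"
    and "continuous_on ({-r<..<r} \<times> {t0..T}) (\<lambda>(\<epsilon>, t). dR \<epsilon> t)"
    and "continuous_on ({-r<..<r} \<times> {t0..T}) (\<lambda>(\<epsilon>, t). d\<Omega> \<epsilon> t)"
    and "\<And>t. t \<in> {t0..T} \<Longrightarrow> Rv 0 t = Rh t"
    and "\<And>t. t \<in> {t0..T} \<Longrightarrow> \<Omega>v 0 t = \<Omega>h t"
    and "\<And>t. t \<in> {t0..T} \<Longrightarrow> dR 0 t = Rh t ** skew (\<Sigma> t)"
    and "\<And>t. t \<in> {t0..T} \<Longrightarrow>
           (\<Sigma> has_vector_derivative d\<Omega> 0 t - cross3 (\<Omega>h t) (\<Sigma> t)) (at t within {t0..T})"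
    and "\<Sigma> t0 = 0" and "\<Sigma> T = 0"
proof -
  have R0: "Rv 0 t = Rh t" if "t \<in> {t0..T}" for t
    using v that unfolding attitude_variation_def by blast
  have R\<Sigma>: "((\<lambda>\<epsilon>. Rv \<epsilon> t) has_vector_derivative Rh t ** skew (\<Sigma> t)) (at 0)" if "t \<in> {t0..T}" for t
    using v that unfolding attitude_variation_def by blast
  obtain r dR d\<Omega> where r: "0 < r"
    and cv: "\<forall>\<epsilon>\<in>{-r<..<r}. attitude_curve t0 T (Rv \<epsilon>) (\<Omega>v \<epsilon>) \<and> Rv \<epsilon> t0 = Rh t0 \<and> Rv \<epsilon> T = Rh T"
    and dv: "\<forall>\<epsilon>\<in>{-r<..<r}. \<forall>t\<in>{t0..T}. ((\<lambda>e. Rv e t) has_vector_derivative dR \<epsilon> t) (at \<epsilon>) \<and>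
           ((\<lambda>e. \<Omega>v e t) has_vector_derivative d\<Omega> \<epsilon> t) (at \<epsilon>)"
    and cont: "continuous_on ({-r<..<r} \<times> {t0..T}) (\<lambda>(\<epsilon>, t). Rv \<epsilon> t)"
      "continuous_on ({-r<..<r} \<times> {t0..T}) (\<lambda>(\<epsilon>, t). \<Omega>v \<epsilon> t)"
      "continuous_on ({-r<..<r} \<times> {t0..T}) (\<lambda>(\<epsilon>, t). dR \<epsilon> t)"
      "continuous_on ({-r<..<r} \<times> {t0..T}) (\<lambda>(\<epsilon>, t). d\<Omega> \<epsilon> t)"
    using v unfolding attitude_variation_def by (elim conjE exE) (rule that)
  define U where "U = {-r<..<r}"
  have 0: "0 \<in> U" "open U" "convex U"
    using r by (auto simp: U_def)
  have ort: "orthogonal_matrix (Rh t)" if "t \<in> {t0..T}" for t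
    using c that by (auto simp: attitude_curve_def rotation_matrix_def)
  have \<Omega>0: "\<Omega>v 0 t = \<Omega>h t" if "t \<in> {t0..T}" for t
    using attitude_curve_velocity_unique[OF assms(1) c] cv 0 R0 that U_def by blast
  have dR0: "dR 0 t = Rh t ** skew (\<Sigma> t)" if "t \<in> {t0..T}" for t
    using vector_derivative_unique_at[OF _ R\<Sigma>[OF that]] dv 0 that U_def by blast
  have \<Sigma>_end: "\<Sigma> t = 0" if "t \<in> {t0..T}" "\<forall>\<epsilon>\<in>U. Rv \<epsilon> t = Rh t" for t
  proof -
    have "((\<lambda>\<epsilon>. Rv \<epsilon> t) has_vector_derivative 0) (at 0)"
      by (rule has_vector_derivative_transform_within_open[OF has_vector_derivative_const 0(2,1)])
        (simp add: that)
    then have "Rh t ** skew (\<Sigma> t) = Rh t ** skew 0"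
      using vector_derivative_unique_at[OF _ R\<Sigma>[OF that(1)]]
      by simp
    then show ?thesis
      using orthogonal_matrix_cancel[OF ort[OF that(1)]] by (metis skew_eq_iff)
  qed
  \<comment> \<open>Here f is the time derivative of \<open>Rv \<epsilon>\<close> by the kinematics,
    and g is the derivative of f in \<epsilon>, that is, the mixed second derivative of the
    family.\<close>
  define f where "f \<epsilon> t = Rv \<epsilon> t ** skew (\<Omega>v \<epsilon> t)" for \<epsilon> t
  define g where "g \<epsilon> t = Rv \<epsilon> t ** skew (d\<Omega> \<epsilon> t) + dR \<epsilon> t ** skew (\<Omega>v \<epsilon> t)" for \<epsilon> t
  have fg: "((\<lambda>\<epsilon>. f \<epsilon> t) has_vector_derivative g \<epsilon> t) (at \<epsilon>)" if "\<epsilon> \<in> U" "t \<in> {t0..T}" for \<epsilon> t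
    unfolding f_def g_def using dv that
    by (intro bounded_bilinear.has_vector_derivative[OF bounded_bilinear_matrix_mult]
        bounded_linear.has_vector_derivative[OF bounded_linear_skew]) (auto simp: U_def)
  have cg: "continuous_on (U \<times> {t0..T}) (\<lambda>(\<epsilon>, t). g \<epsilon> t)"
    using cont unfolding g_def U_def case_prod_beta
    by (intro continuous_on_add continuous_on_matrix_mult continuous_on_skew)
  have cg0: "continuous_on {t0..T} (g 0)"
    by (rule continuous_on_compose2[OF cg, of _ "Pair 0", simplified])
       (use 0 in \<open>auto intro!: continuous_intros\<close>)
  have FTC: "(f \<epsilon> has_integral Rv \<epsilon> t - Rh t0) {t0..t}" if "\<epsilon> \<in> U" "t \<in> {t0..T}" for \<epsilon> t
  proof -
    have "(Rv \<epsilon> has_vector_derivative f \<epsilon> s) (at s within {t0..t})" if "s \<in> {t0..t}" for s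
      using cv that \<open>\<epsilon> \<in> U\<close> \<open>t \<in> {t0..T}\<close> unfolding U_def attitude_curve_def f_def
      by (intro has_vector_derivative_within_subset[of _ _ s "{t0..T}" "{t0..t}"]) auto
    then have "(f \<epsilon> has_integral Rv \<epsilon> t - Rv \<epsilon> t0) {t0..t}"
      using that by (intro fundamental_theorem_of_calculus) auto
    then show ?thesis using cv that U_def by simp
  qed
  \<comment> \<open>Differentiating the integrated kinematics in \<open>\<epsilon>\<close> avoids assuming that \<open>dR\<close> is
    differentiable in \<open>t\<close>.\<close>
  have dR_int: "dR 0 t = integral {t0..t} (g 0)" if t: "t \<in> {t0..T}" for t
  proof -
    have "((\<lambda>\<epsilon>. integral (cbox t0 t) (f \<epsilon>)) has_vector_derivative integral (cbox t0 t) (g 0)) (at 0 within U)"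
    proof (rule leibniz_rule_vector_derivative[OF _ _ _ 0(1,3)])
      show "((\<lambda>x. f x s) has_vector_derivative g x s) (at x within U)" if "x \<in> U" "s \<in> cbox t0 t" for x s
        using fg[OF that(1), of s] that t by (auto intro: has_vector_derivative_at_within)
      show "f x integrable_on cbox t0 t" if "x \<in> U" for x
        using FTC[OF that t] by (auto simp: integrable_on_def cbox_interval)
      show "continuous_on (U \<times> cbox t0 t) (\<lambda>(x, t). g x t)"
        by (rule continuous_on_subset[OF cg]) (use t in auto)
    qed
    then have "((\<lambda>\<epsilon>. Rh t0 + integral {t0..t} (f \<epsilon>)) has_vector_derivative integral {t0..t} (g 0)) (at 0)"
      using has_vector_derivative_add[OF has_vector_derivative_const[of "Rh t0"]]
      by (fastforce simp: at_within_open[OF 0(1,2)] cbox_interval)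
    then have "((\<lambda>\<epsilon>. Rv \<epsilon> t) has_vector_derivative integral {t0..t} (g 0)) (at 0)"
      by (rule has_vector_derivative_transform_within_open[OF _ 0(2,1)])
        (simp add: integral_unique[OF FTC[OF _ t]])
    then show ?thesis
      using vector_derivative_unique_at dv 0 t U_def by blast
  qed
  have "(\<Sigma> has_vector_derivative d\<Omega> 0 t - cross3 (\<Omega>h t) (\<Sigma> t)) (at t within {t0..T})"
    if t: "t \<in> {t0..T}" for t
  proof -
    have *: "(dR 0 has_vector_derivative g 0 t) (at t within {t0..T})"
      by (rule has_vector_derivative_transform[OF t _ integral_has_vector_derivative[OF cg0 t]])
        (simp add: dR_int)
    have "(Rh has_vector_derivative Rh t ** skew (\<Omega>h t)) (at t within {t0..T})"
      using c t unfolding attitude_curve_def by blast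
    then have "((\<lambda>t. transpose (Rh t)) has_vector_derivative transpose (Rh t ** skew (\<Omega>h t))) (at t within {t0..T})"
      by (rule bounded_linear.has_vector_derivative[OF bounded_linear_transpose])
    from bounded_bilinear.has_vector_derivative[OF bounded_bilinear_matrix_mult this *]
    have deriv: "((\<lambda>t. transpose (Rh t) ** dR 0 t) has_vector_derivative
        transpose (Rh t) ** g 0 t + transpose (Rh t ** skew (\<Omega>h t)) ** dR 0 t) (at t within {t0..T})" .
    have oo: "transpose (Rh t) ** Rh t = mat 1" if "t \<in> {t0..T}" for t
      using ort[OF that] by (simp add: orthogonal_matrix)
    \<comment> \<open>The transpose of a skew matrix supplies the minus sign, and the two products
      of \<open>skew (\<Sigma> t)\<close> and \<open>skew (\<Omega>h t)\<close> combine to a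
      commutator, equal to the skew matrix of - \<Omega> x \<Sigma>.\<close>
    have "transpose (Rh t) ** g 0 t + transpose (Rh t ** skew (\<Omega>h t)) ** dR 0 t
      = (transpose (Rh t) ** Rh t) ** skew (d\<Omega> 0 t) + (transpose (Rh t) ** Rh t) ** skew (\<Sigma> t) ** skew (\<Omega>h t)
        - skew (\<Omega>h t) ** (transpose (Rh t) ** Rh t) ** skew (\<Sigma> t)"
      using t by (simp add: g_def R0 \<Omega>0 dR0 matrix_transpose_mul transpose_skew matrix_add_ldistrib
          matrix_mul_assoc matrix_mult.minus_left)
    also have "\<dots> = skew (d\<Omega> 0 t - cross3 (\<Omega>h t) (\<Sigma> t))"
      by (simp add: oo[OF t] skew_diff skew_cross)
    finally have eq: "transpose (Rh t) ** g 0 t + transpose (Rh t ** skew (\<Omega>h t)) ** dR 0 t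
      = skew (d\<Omega> 0 t - cross3 (\<Omega>h t) (\<Sigma> t))" .
    have d: "((\<lambda>t. transpose (Rh t) ** dR 0 t) has_vector_derivative
        skew (d\<Omega> 0 t - cross3 (\<Omega>h t) (\<Sigma> t))) (at t within {t0..T})"
      using deriv unfolding eq .
    have "((\<lambda>t. skew (\<Sigma> t)) has_vector_derivative
        skew (d\<Omega> 0 t - cross3 (\<Omega>h t) (\<Sigma> t))) (at t within {t0..T})"
      by (rule has_vector_derivative_transform[OF t _ d]) (simp add: dR0 matrix_mul_assoc oo)
    \<comment> \<open>A globally linear left inverse is needed to strip \<open>skew\<close> from a
      derivative; \<open>vex\<close> is specified only on the range of \<open>skew\<close>.\<close>
    moreover obtain h where h: "linear h" "h \<circ> skew = id"
      using linear_injective_left_inverse[OF _ inj_skew] bounded_linear.linear[OF bounded_linear_skew] by blast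
    moreover have "h (skew a) = a" for a
      using fun_cong[OF h(2)] by simp
    ultimately show ?thesis
      using bounded_linear.has_vector_derivative[of h "\<lambda>t. skew (\<Sigma> t)"]
      by (fastforce simp: linear_conv_bounded_linear)
  qed
  moreover have "\<Sigma> t0 = 0" "\<Sigma> T = 0"
    using \<Sigma>_end[of t0] \<Sigma>_end[of T] cv assms(1) by (auto simp: U_def)
  ultimately show thesis
    using that[of r dR d\<Omega>] r dv cont R0 \<Omega>0 dR0 by blast
qed

section \<open>Differentiation of the action along a variation\<close>

lemma potential_shapeD:
  assumes "potential_shape \<Phi> \<Phi>'"
  shows "\<And>x. 0 \<le> x \<Longrightarrow> (\<Phi> has_real_derivative \<Phi>' x) (at x within {0..})"
    and "continuous_on {0..} \<Phi>" and "continuous_on {0..} \<Phi>'"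
proof -
  show d: "(\<Phi> has_real_derivative \<Phi>' x) (at x within {0..})" if "0 \<le> x" for x
    using assms that unfolding potential_shape_def by blast
  then show "continuous_on {0..} \<Phi>" by (auto intro!: DERIV_continuous_on)
  obtain \<Phi>'' where "\<forall>x\<ge>0. (\<Phi>' has_real_derivative \<Phi>'' x) (at x within {0..})"
    using assms unfolding potential_shape_def by blast
  then show "continuous_on {0..} \<Phi>'" by (intro DERIV_continuous_on[of _ _ \<Phi>'']) auto
qed

lemma continuous_on_U0:
  assumes "continuous_on X A" "continuous_on X U"
  shows "continuous_on X (\<lambda>x. U0 E W (A x) (U x))"
  unfolding U0_def frob_inner_eq_inner
  by (intro continuous_on_mult continuous_on_const continuous_on_inner continuous_on_diff
      continuous_on_matrix_mult assms)

lemma continuous_on_dU0: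
  assumes "continuous_on X A" "continuous_on X U" "continuous_on X H"
  shows "continuous_on X (\<lambda>x. dU0 E W (A x) (U x) (H x))"
  unfolding dU0_def
  by (intro continuous_on_minus continuous_on_const continuous_on_inner continuous_on_diff
      continuous_on_matrix_mult assms)

text \<open>The Lagrangian is differentiated under the integral sign, which the joint continuity of
  its \<epsilon>-derivative permits. Integrability is recorded too, so that the virtual work of the
  dissipation can later be added under one integral.\<close>

lemma action_has_derivative:
  fixes E :: "real^'n^3" and W :: "real^'n^'n"
  assumes "t0 < T"
    and Um: "continuous_on {t0..T} Um" and \<Omega>m: "continuous_on {t0..T} \<Omega>m"
    and \<beta>h: "continuous_on {t0..T} \<beta>h"
    and W: "pos_def_matrix W" "transpose W = W"
    and \<Phi>: "potential_shape \<Phi> \<Phi>'"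
    and c: "attitude_curve t0 T Rh \<Omega>h"
    and v: "attitude_variation t0 T Rh Rv \<Omega>v \<Sigma>"
  obtains \<Sigma>' where "\<And>t. t \<in> {t0..T} \<Longrightarrow> (\<Sigma> has_vector_derivative \<Sigma>' t) (at t within {t0..T})"
    and "\<Sigma> t0 = 0" and "\<Sigma> T = 0"
    and "((\<lambda>\<epsilon>. action m \<Phi> E W Um \<Omega>m \<beta>h t0 T (Rv \<epsilon>) (\<Omega>v \<epsilon>)) has_real_derivative
        integral {t0..T} (\<lambda>s. - m * ((\<Omega>m s - \<Omega>h s - \<beta>h s) \<bullet> (\<Sigma>' s + cross3 (\<Omega>h s) (\<Sigma> s)))
          - \<Phi>' (U0 E W (Rh s) (Um s)) * (S_L (E ** W ** transpose (Um s)) (Rh s) \<bullet> \<Sigma> s))) (at 0)"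
    and "(\<lambda>s. - m * ((\<Omega>m s - \<Omega>h s - \<beta>h s) \<bullet> (\<Sigma>' s + cross3 (\<Omega>h s) (\<Sigma> s)))
          - \<Phi>' (U0 E W (Rh s) (Um s)) * (S_L (E ** W ** transpose (Um s)) (Rh s) \<bullet> \<Sigma> s)) integrable_on {t0..T}"
proof -
  obtain r dR d\<Omega> where r: "0 < r"
    and dRv: "\<And>\<epsilon> t. \<epsilon> \<in> {-r<..<r} \<Longrightarrow> t \<in> {t0..T} \<Longrightarrow> ((\<lambda>e. Rv e t) has_vector_derivative dR \<epsilon> t) (at \<epsilon>)"
    and d\<Omega>v: "\<And>\<epsilon> t. \<epsilon> \<in> {-r<..<r} \<Longrightarrow> t \<in> {t0..T} \<Longrightarrow> ((\<lambda>e. \<Omega>v e t) has_vector_derivative d\<Omega> \<epsilon> t) (at \<epsilon>)"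
    and cont: "continuous_on ({-r<..<r} \<times> {t0..T}) (\<lambda>(\<epsilon>, t). Rv \<epsilon> t)"
      "continuous_on ({-r<..<r} \<times> {t0..T}) (\<lambda>(\<epsilon>, t). \<Omega>v \<epsilon> t)"
      "continuous_on ({-r<..<r} \<times> {t0..T}) (\<lambda>(\<epsilon>, t). dR \<epsilon> t)"
      "continuous_on ({-r<..<r} \<times> {t0..T}) (\<lambda>(\<epsilon>, t). d\<Omega> \<epsilon> t)"
    and R0: "\<And>t. t \<in> {t0..T} \<Longrightarrow> Rv 0 t = Rh t"
    and \<Omega>0: "\<And>t. t \<in> {t0..T} \<Longrightarrow> \<Omega>v 0 t = \<Omega>h t"
    and dR0: "\<And>t. t \<in> {t0..T} \<Longrightarrow> dR 0 t = Rh t ** skew (\<Sigma> t)"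
    and d\<Sigma>: "\<And>t. t \<in> {t0..T} \<Longrightarrow>
           (\<Sigma> has_vector_derivative d\<Omega> 0 t - cross3 (\<Omega>h t) (\<Sigma> t)) (at t within {t0..T})"
    and ends: "\<Sigma> t0 = 0" "\<Sigma> T = 0"
    by (rule attitude_variation_reduced[OF assms(1) c v]) (rule that)
  define U where "U = {-r<..<r}"
  define X where "X = U \<times> {t0..T}"
  have 0: "0 \<in> U" "open U" "convex U"
    using r by (auto simp: U_def)
  note cont' = cont[folded U_def, folded X_def, unfolded case_prod_beta]
  have snd: "continuous_on X (\<lambda>x. h (snd x))"
    if "continuous_on {t0..T} h" for h :: "real \<Rightarrow> 'z::topological_space"
    by (rule continuous_on_compose2[OF that continuous_on_snd[OF continuous_on_id]]) (auto simp: X_def)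
  define \<omega> where "\<omega> \<epsilon> s = \<Omega>m s - \<Omega>v \<epsilon> s - \<beta>h s" for \<epsilon> s
  define f where "f \<epsilon> s = m / 2 * (\<omega> \<epsilon> s \<bullet> \<omega> \<epsilon> s) - \<Phi> (U0 E W (Rv \<epsilon> s) (Um s))" for \<epsilon> s
  define g where "g \<epsilon> s = - m * (\<omega> \<epsilon> s \<bullet> d\<Omega> \<epsilon> s)
      - \<Phi>' (U0 E W (Rv \<epsilon> s) (Um s)) * dU0 E W (Rv \<epsilon> s) (Um s) (dR \<epsilon> s)" for \<epsilon> s
  have c\<omega>: "continuous_on X (\<lambda>x. \<omega> (fst x) (snd x))"
    unfolding \<omega>_def by (intro continuous_on_diff cont' snd \<Omega>m \<beta>h)
  have cU0: "continuous_on X (\<lambda>x. U0 E W (Rv (fst x) (snd x)) (Um (snd x)))"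
    by (intro continuous_on_U0 cont' snd Um)
  have c\<Phi>: "continuous_on X (\<lambda>x. \<phi> (U0 E W (Rv (fst x) (snd x)) (Um (snd x))))"
    if "continuous_on {0..} \<phi>" for \<phi> :: "real \<Rightarrow> real"
    by (rule continuous_on_compose2[OF that cU0]) (use U0_nonneg[OF W(1)] in auto)
  have cf: "continuous_on X (\<lambda>x. f (fst x) (snd x))"
    unfolding f_def by (intro continuous_intros c\<omega> c\<Phi> potential_shapeD(2)[OF \<Phi>])
  have cg: "continuous_on X (\<lambda>x. g (fst x) (snd x))"
    unfolding g_def
    by (intro continuous_intros c\<omega> c\<Phi> potential_shapeD(3)[OF \<Phi>] continuous_on_dU0 cont' snd Um)
  have fg: "((\<lambda>e. f e s) has_vector_derivative g \<epsilon> s) (at \<epsilon>)" if "\<epsilon> \<in> U" "s \<in> {t0..T}" for \<epsilon> s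
  proof -
    have 1: "((\<lambda>e. \<omega> e s) has_vector_derivative - d\<Omega> \<epsilon> s) (at \<epsilon>)"
      unfolding \<omega>_def using d\<Omega>v that U_def by (auto intro!: derivative_eq_intros)
    have 2: "((\<lambda>e. \<omega> e s \<bullet> \<omega> e s) has_real_derivative - 2 * (\<omega> \<epsilon> s \<bullet> d\<Omega> \<epsilon> s)) (at \<epsilon>)"
      using bounded_bilinear.has_vector_derivative[OF bounded_bilinear_inner 1 1]
      by (simp add: has_real_derivative_iff_has_vector_derivative inner_commute)
    have "((\<lambda>e. U0 E W (Rv e s) (Um s)) has_real_derivative
        dU0 E W (Rv \<epsilon> s) (Um s) (dR \<epsilon> s)) (at \<epsilon>)"
      using U0_has_vector_derivative[OF W(2) dRv] that U_def
      by (simp add: has_real_derivative_iff_has_vector_derivative)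
    \<comment> \<open>At 0 the function \<Phi> has only a one-sided derivative. The chain rule is
      therefore used within the range of the potential, which lies in the nonnegative reals.\<close>
    moreover have "(\<Phi> has_real_derivative \<Phi>' (U0 E W (Rv \<epsilon> s) (Um s)))
        (at (U0 E W (Rv \<epsilon> s) (Um s)) within range (\<lambda>e. U0 E W (Rv e s) (Um s)))"
      by (rule has_field_derivative_subset[OF potential_shapeD(1)[OF \<Phi> U0_nonneg[OF W(1)]]])
        (use U0_nonneg[OF W(1)] in auto)
    ultimately have "((\<lambda>e. \<Phi> (U0 E W (Rv e s) (Um s))) has_real_derivative
        \<Phi>' (U0 E W (Rv \<epsilon> s) (Um s)) * dU0 E W (Rv \<epsilon> s) (Um s) (dR \<epsilon> s)) (at \<epsilon>)"
      using DERIV_image_chain[of \<Phi> _ "\<lambda>e. U0 E W (Rv e s) (Um s)" \<epsilon> UNIV] by (simp add: o_def)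
    from DERIV_diff[OF DERIV_cmult[OF 2, of "m / 2"] this] show ?thesis
      by (simp add: f_def g_def has_real_derivative_iff_has_vector_derivative)
  qed
  have "((\<lambda>\<epsilon>. integral (cbox t0 T) (f \<epsilon>)) has_vector_derivative integral (cbox t0 T) (g 0)) (at 0 within U)"
  proof (rule leibniz_rule_vector_derivative[OF _ _ _ 0(1,3)])
    show "((\<lambda>x. f x s) has_vector_derivative g x s) (at x within U)" if "x \<in> U" "s \<in> cbox t0 T" for x s
      using fg[OF that(1), of s] that by (auto intro: has_vector_derivative_at_within)
    show "f x integrable_on cbox t0 T" if "x \<in> U" for x
      using that by (intro integrable_continuous continuous_on_compose2[OF cf, of _ "Pair x", simplified])
        (auto intro!: continuous_intros simp: X_def)
    show "continuous_on (U \<times> cbox t0 T) (\<lambda>(x, t). g x t)"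
      using cg by (simp add: X_def case_prod_beta cbox_interval)
  qed
  then have d: "((\<lambda>\<epsilon>. action m \<Phi> E W Um \<Omega>m \<beta>h t0 T (Rv \<epsilon>) (\<Omega>v \<epsilon>)) has_real_derivative integral {t0..T} (g 0)) (at 0)"
    by (simp add: action_def f_def[abs_def] \<omega>_def at_within_open[OF 0(1,2)] cbox_interval
        has_real_derivative_iff_has_vector_derivative)
  \<comment> \<open>This is \<delta>\<Omega> = \<Sigma>' + \<Omega> x \<Sigma> solved for \<Sigma>',
    so that g at \<epsilon> = 0 becomes an expression in \<Sigma> and \<Sigma>' alone.\<close>
  define \<Sigma>' where "\<Sigma>' t = d\<Omega> 0 t - cross3 (\<Omega>h t) (\<Sigma> t)" for t
  define k where "k s = - m * ((\<Omega>m s - \<Omega>h s - \<beta>h s) \<bullet> (\<Sigma>' s + cross3 (\<Omega>h s) (\<Sigma> s)))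
      - \<Phi>' (U0 E W (Rh s) (Um s)) * (S_L (E ** W ** transpose (Um s)) (Rh s) \<bullet> \<Sigma> s)" for s
  have gk: "g 0 s = k s" if s: "s \<in> {t0..T}" for s
  proof -
    have "rotation_matrix (Rh s)"
      using c s by (auto simp: attitude_curve_def)
    then show ?thesis
      using s by (simp add: k_def g_def \<omega>_def \<Sigma>'_def R0 \<Omega>0 dR0 dU0_body[OF W(2)])
  qed
  have "g 0 integrable_on {t0..T}"
    by (intro integrable_continuous_real continuous_on_compose2[OF cg, of _ "Pair 0", simplified])
      (use 0 in \<open>auto intro!: continuous_intros simp: X_def\<close>)
  then have k: "k integrable_on {t0..T}"
    using gk by (rule integrable_eq)
  have "integral {t0..T} (g 0) = integral {t0..T} k"
    using gk by (rule integral_cong)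
  with d have d': "((\<lambda>\<epsilon>. action m \<Phi> E W Um \<Omega>m \<beta>h t0 T (Rv \<epsilon>) (\<Omega>v \<epsilon>)) has_real_derivative integral {t0..T} k) (at 0)"
    by simp
  show thesis
    by (rule that[of \<Sigma>', folded k_def, OF _ ends d' k]) (simp add: \<Sigma>'_def d\<Sigma>)
qed

text \<open>The scalar triple product gives \<omega> . (\<Omega> x \<Sigma>) = - (\<Omega> x
  \<omega>) . \<Sigma>, the origin of the gyroscopic term of the filter.\<close>

lemma virtual_work_integrand_eq:
  fixes \<omega> \<omega>' \<Sigma> \<Sigma>' \<Omega> q S :: "real^3"
  shows "- m * (\<omega> \<bullet> (\<Sigma>' + cross3 \<Omega> \<Sigma>)) - p * (S \<bullet> \<Sigma>) + q \<bullet> \<Sigma>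
    = (m *\<^sub>R cross3 \<Omega> \<omega> - p *\<^sub>R S + q) \<bullet> \<Sigma> - m * (\<omega> \<bullet> \<Sigma>')"
  by (simp add: cross3_def inner_vec_def sum_3 algebra_simps)

section \<open>The fundamental lemma of the calculus of variations\<close>

text \<open>With Q a primitive of q, the claim is that Q + p is constant. Testing against the
  primitive f of the deviation h of Q + p from its mean forces the integral of h squared to
  vanish.\<close>

lemma du_bois_reymond:
  fixes p q :: "real \<Rightarrow> real"
  assumes "a < b" and p: "continuous_on {a..b} p" and q: "continuous_on {a..b} q"
    and vanish: "\<And>f f'. (\<And>t. t \<in> {a..b} \<Longrightarrow> (f has_real_derivative f' t) (at t within {a..b})) \<Longrightarrow>
      continuous_on {a..b} f' \<Longrightarrow> f a = 0 \<Longrightarrow> f b = 0 \<Longrightarrow>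
      integral {a..b} (\<lambda>t. q t * f t - p t * f' t) = 0"
    and t: "t \<in> {a..b}"
  shows "(p has_real_derivative - q t) (at t within {a..b})"
proof -
  define Q where "Q t = integral {a..t} q" for t
  have Q: "(Q has_real_derivative q t) (at t within {a..b})" if "t \<in> {a..b}" for t
    unfolding Q_def[abs_def] has_real_derivative_iff_has_vector_derivative
    by (rule integral_has_vector_derivative[OF q that])
  then have cQ: "continuous_on {a..b} Q"
    by (rule DERIV_continuous_on)
  \<comment> \<open>The mean value of Q + p is the constant for which the primitive f of h also
    vanishes at b.\<close>
  define c where "c = integral {a..b} (\<lambda>s. Q s + p s) / (b - a)"
  define h where "h s = Q s + p s - c" for s
  define f where "f t = integral {a..t} h" for t
  have ch: "continuous_on {a..b} h"
    unfolding h_def by (intro continuous_intros cQ p)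
  have f: "(f has_real_derivative h t) (at t within {a..b})" if "t \<in> {a..b}" for t
    unfolding f_def[abs_def] has_real_derivative_iff_has_vector_derivative
    by (rule integral_has_vector_derivative[OF ch that])
  then have cf: "continuous_on {a..b} f"
    by (rule DERIV_continuous_on)
  have fa: "f a = 0"
    by (simp add: f_def)
  have "integral {a..b} h = integral {a..b} (\<lambda>s. Q s + p s) - integral {a..b} (\<lambda>s. c)"
    unfolding h_def by (intro integral_diff integrable_continuous_real continuous_intros cQ p)
  then have fb: "f b = 0"
    using assms(1) by (simp add: f_def c_def)
  have 1: "integral {a..b} (\<lambda>t. q t * f t - p t * h t) = 0"
    using vanish[OF f ch fa fb] .
  have "((\<lambda>t. Q t * f t) has_real_derivative Q t * h t + q t * f t) (at t within {a..b})"
    if "t \<in> {a..b}" for t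
    using DERIV_mult[OF Q f] that by (simp add: mult_ac add_ac)
  then have "((\<lambda>t. Q t * h t + q t * f t) has_integral Q b * f b - Q a * f a) {a..b}"
    using assms(1)
    by (intro fundamental_theorem_of_calculus)
      (auto simp: has_real_derivative_iff_has_vector_derivative)
  then have 2: "integral {a..b} (\<lambda>t. Q t * h t + q t * f t) = 0"
    by (simp add: fa fb integral_unique)
  \<comment> \<open>One factor h is expanded as Q + p - c. The three resulting integrals vanish: the
    first integrand is the derivative of Q f, the second is the tested one, and the integral of h is
    f b.\<close>
  have "(\<lambda>t. h t * h t) = (\<lambda>t. ((Q t * h t + q t * f t) - (q t * f t - p t * h t)) - c * h t)"
    by (simp add: h_def algebra_simps)
  moreover have "(\<lambda>t. Q t * h t + q t * f t) integrable_on {a..b}"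
    and "(\<lambda>t. q t * f t - p t * h t) integrable_on {a..b}"
    and "(\<lambda>t. c * h t) integrable_on {a..b}"
    by (intro integrable_continuous_real continuous_intros cQ p q ch cf)+
  ultimately have "integral {a..b} (\<lambda>t. h t * h t) = integral {a..b} (\<lambda>t. Q t * h t + q t * f t)
      - integral {a..b} (\<lambda>t. q t * f t - p t * h t) - integral {a..b} (\<lambda>t. c * h t)"
    by (simp only: integral_diff integrable_diff)
  also have "\<dots> = 0"
    using 1 2 fb by (simp add: f_def)
  finally have "integral {a..b} (\<lambda>t. h t * h t) = 0" .
  moreover have "continuous_on {a..b} (\<lambda>t. h t * h t)"
    by (intro continuous_intros ch)
  ultimately have h0: "\<forall>t\<in>{a..b}. h t * h t = 0"
    using integral_eq_0_iff[of a b "\<lambda>t. h t * h t"] assms(1) by simp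
  have "p s = c - Q s" if "s \<in> {a..b}" for s
  proof -
    have "h s = 0"
      using h0 that by simp
    then show ?thesis by (simp add: h_def)
  qed
  moreover have "((\<lambda>s. c - Q s) has_real_derivative - q t) (at t within {a..b})"
    using Q[OF t] by (auto intro!: derivative_eq_intros)
  ultimately show ?thesis
    unfolding has_real_derivative_iff_has_vector_derivative
    by (rule has_vector_derivative_transform[OF t])
qed

section \<open>Rotations about a fixed axis\<close>

text \<open>For a unit vector e this is the matrix exponential of \<theta> times
  \<open>skew e\<close>. The closed form reduces its properties to identities among powers of
  \<open>skew e\<close> and trigonometric functions.\<close>

definition rodrigues :: "real^3 \<Rightarrow> real \<Rightarrow> real^3^3" where
  "rodrigues e \<theta> = mat 1 + sin \<theta> *\<^sub>R skew e + (1 - cos \<theta>) *\<^sub>R (skew e ** skew e)"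

lemma rodrigues_0 [simp]: "rodrigues e 0 = mat 1"
  by (simp add: rodrigues_def)

text \<open>The Cayley-Hamilton identity for \<open>skew e\<close>; for unit e, all products reduce
  to the span of 1, K and K^2 with K = \<open>skew e\<close>.\<close>

lemma skew_cube: "skew e ** skew e ** skew e = - ((e \<bullet> e) *\<^sub>R skew e)"
  by (simp add: vec_eq_iff forall_3 matrix_matrix_mult_def sum_3 inner_vec_def algebra_simps)

lemma skew_rodrigues_commute: "skew e ** rodrigues e \<theta> = rodrigues e \<theta> ** skew e"
  by (simp add: rodrigues_def matrix_mult.add_left matrix_mult.add_right matrix_mult.scaleR_left matrix_mult.scaleR_right matrix_mul_assoc)

lemma rodrigues_mult:
  assumes "norm e = 1"
  shows "rodrigues e a ** rodrigues e b = rodrigues e (a + b)"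
proof -
  have 3: "skew e ** skew e ** skew e = - skew e"
    using assms by (simp add: skew_cube dot_square_norm)
  then have "skew e ** skew e ** skew e ** skew e = - (skew e ** skew e)"
    by (simp add: matrix_mult.minus_left)
  \<comment> \<open>The general product in the algebra spanned by 1, K, K^2 with K^3 = - K;
    inserting sines and 1 - cosines turns the coefficients into the addition formulas.\<close>
  with 3 have *: "(mat 1 + s *\<^sub>R skew e + c *\<^sub>R (skew e ** skew e)) ** (mat 1 + s' *\<^sub>R skew e + c' *\<^sub>R (skew e ** skew e))
      = mat 1 + (s + s' - s * c' - c * s') *\<^sub>R skew e + (c + c' + s * s' - c * c') *\<^sub>R (skew e ** skew e)"
    for s c s' c'
    by (simp add: matrix_mult.add_left matrix_mult.add_right matrix_mult.diff_left matrix_mult.scaleR_left matrix_mult.scaleR_right matrix_mul_assoc)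
      (simp add: algebra_simps)
  show ?thesis
    unfolding rodrigues_def * sin_add cos_add by (simp add: algebra_simps)
qed

lemma transpose_rodrigues: "transpose (rodrigues e \<theta>) = rodrigues e (- \<theta>)"
  by (simp add: rodrigues_def vec_eq_iff forall_3 transpose_def matrix_matrix_mult_def sum_3 mat_def algebra_simps)

lemma rotation_matrix_rodrigues:
  assumes "norm e = 1"
  shows "rotation_matrix (rodrigues e \<theta>)"
proof -
  have orth: "orthogonal_matrix (rodrigues e x)" for x
    by (simp add: orthogonal_matrix transpose_rodrigues rodrigues_mult[OF assms])
  \<comment> \<open>A half-angle square root makes the determinant a square, which excludes \<open>-1\<close>.\<close>
  have "det (rodrigues e \<theta>) = (det (rodrigues e (\<theta> / 2)))\<^sup>2"
    by (simp add: power2_eq_square det_mul[symmetric] rodrigues_mult[OF assms])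
  also have "\<dots> = 1"
    using det_orthogonal_matrix[OF orth, of "\<theta> / 2"] by auto
  finally show ?thesis
    by (simp add: rotation_matrix_def orth)
qed

lemma rodrigues_has_vector_derivative:
  assumes "norm e = 1"
  shows "(rodrigues e has_vector_derivative skew e ** rodrigues e \<theta>) (at \<theta>)"
proof -
  have "skew e ** skew e ** skew e = - skew e"
    using assms by (simp add: skew_cube dot_square_norm)
  then have eq: "skew e ** rodrigues e \<theta> = cos \<theta> *\<^sub>R skew e + sin \<theta> *\<^sub>R (skew e ** skew e)"
    by (simp add: rodrigues_def matrix_mult.add_right matrix_mult.scaleR_right matrix_mul_assoc) (simp add: algebra_simps)
  show ?thesis
    unfolding eq unfolding rodrigues_def[abs_def]
    by (auto intro!: derivative_eq_intros)
qed

lemma rodrigues_compose_derivative: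
  assumes "norm e = 1" and "(g has_real_derivative g') (at x within X)"
  shows "((\<lambda>x. rodrigues e (g x)) has_vector_derivative g' *\<^sub>R (skew e ** rodrigues e (g x))) (at x within X)"
  using vector_diff_chain_within[OF assms(2)[unfolded has_real_derivative_iff_has_vector_derivative],
      of "rodrigues e"] rodrigues_has_vector_derivative[OF assms(1)]
  by (simp add: o_def has_vector_derivative_at_within)

text \<open>Rotations preserve the cross product. Both sides are compared on vectors x, rewritten as
  Q^T (Q x).\<close>

lemma skew_rotate:
  assumes "rotation_matrix Q"
  shows "skew (transpose Q *v a) = transpose Q ** skew a ** Q"
proof -
  have QQ: "transpose Q ** Q = mat 1" and r: "rotation_matrix (transpose Q)"
    using assms by (auto simp: rotation_matrix_def orthogonal_matrix[symmetric])
  have "skew (transpose Q *v a) *v x = (transpose Q ** skew a ** Q) *v x" for x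
  proof -
    have "skew (transpose Q *v a) *v x = cross3 (transpose Q *v a) (transpose Q *v (Q *v x))"
      by (simp add: skew_mult_vector matrix_vector_mul_assoc QQ)
    also have "\<dots> = (transpose Q ** skew a ** Q) *v x"
      unfolding cross_rotation_matrix[OF r]
      by (simp add: matrix_vector_mul_assoc[symmetric] skew_mult_vector)
    finally show ?thesis .
  qed
  then show ?thesis by (simp add: matrix_eq)
qed

text \<open>The rotation Q about the body axis e multiplies on the right, so the body velocity is
  \<Omega> conjugated by Q plus \<epsilon> f' e; the second term is not conjugated because Q
  commutes with \<open>skew e\<close>. At \<epsilon> = 0, Q is the identity, whence \<Sigma> = f
  e.\<close>

lemma rotated_curve_variation:
  fixes f f' :: "real \<Rightarrow> real"
  assumes c: "attitude_curve t0 T Rh \<Omega>h" and e: "norm e = 1"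
    and f: "\<And>t. t \<in> {t0..T} \<Longrightarrow> (f has_real_derivative f' t) (at t within {t0..T})"
    and f': "continuous_on {t0..T} f'" and ends: "f t0 = 0" "f T = 0"
  shows "attitude_variation t0 T Rh (\<lambda>\<epsilon> t. Rh t ** rodrigues e (\<epsilon> * f t))
    (\<lambda>\<epsilon> t. transpose (rodrigues e (\<epsilon> * f t)) *v \<Omega>h t + (\<epsilon> * f' t) *\<^sub>R e) (\<lambda>t. f t *\<^sub>R e)"
proof -
  let ?Q = "\<lambda>\<epsilon> t. rodrigues e (\<epsilon> * f t)"
  let ?R = "\<lambda>\<epsilon> t. Rh t ** ?Q \<epsilon> t"
  let ?\<Omega> = "\<lambda>\<epsilon> t. transpose (?Q \<epsilon> t) *v \<Omega>h t + (\<epsilon> * f' t) *\<^sub>R e"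
  let ?dQ = "\<lambda>\<epsilon> t. f t *\<^sub>R (skew e ** ?Q \<epsilon> t)"
  let ?dR = "\<lambda>\<epsilon> t. Rh t ** ?dQ \<epsilon> t"
  let ?d\<Omega> = "\<lambda>\<epsilon> t. transpose (?dQ \<epsilon> t) *v \<Omega>h t + f' t *\<^sub>R e"
  let ?X = "{-1<..<1} \<times> {t0..T}"
  have rot: "rotation_matrix (Rh t)" and dRh: "(Rh has_vector_derivative Rh t ** skew (\<Omega>h t)) (at t within {t0..T})"
    if "t \<in> {t0..T}" for t
    using c that by (auto simp: attitude_curve_def)
  have c\<Omega>: "continuous_on {t0..T} \<Omega>h"
    using c by (auto simp: attitude_curve_def)
  have cRh: "continuous_on {t0..T} Rh"
    using dRh by (rule continuous_on_vector_derivative)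
  have cf: "continuous_on {t0..T} f"
    using f by (rule DERIV_continuous_on)
  have dQ: "((\<lambda>\<epsilon>. ?Q \<epsilon> t) has_vector_derivative ?dQ \<epsilon> t) (at \<epsilon>)" for \<epsilon> t
    by (rule rodrigues_compose_derivative[OF e]) (auto intro!: derivative_eq_intros)
  have dR: "((\<lambda>\<epsilon>. ?R \<epsilon> t) has_vector_derivative ?dR \<epsilon> t) (at \<epsilon>)" for \<epsilon> t
    by (rule bounded_linear.has_vector_derivative[OF matrix_mult.bounded_linear_right dQ])
  have d\<Omega>: "((\<lambda>\<epsilon>. ?\<Omega> \<epsilon> t) has_vector_derivative ?d\<Omega> \<epsilon> t) (at \<epsilon>)" for \<epsilon> t
    by (intro has_vector_derivative_add
        bounded_linear.has_vector_derivative[OF bounded_bilinear.bounded_linear_left[OF bounded_bilinear_matrix_vector_mult]]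
        bounded_linear.has_vector_derivative[OF bounded_linear_transpose] dQ)
      (auto intro!: derivative_eq_intros simp: has_vector_derivative_def)
  have curve: "attitude_curve t0 T (?R \<epsilon>) (?\<Omega> \<epsilon>)" for \<epsilon>
    unfolding attitude_curve_def
  proof (intro conjI ballI)
    fix t assume t: "t \<in> {t0..T}"
    have r: "rotation_matrix (?Q \<epsilon> t)"
      by (rule rotation_matrix_rodrigues[OF e])
    then have QQ: "?Q \<epsilon> t ** transpose (?Q \<epsilon> t) = mat 1"
      by (simp add: rotation_matrix_def orthogonal_matrix_def)
    show "rotation_matrix (?R \<epsilon> t)"
      using rot[OF t] r by (auto simp: rotation_matrix_def orthogonal_matrix_mul det_mul)
    have "((\<lambda>t. ?Q \<epsilon> t) has_vector_derivative (\<epsilon> * f' t) *\<^sub>R (skew e ** ?Q \<epsilon> t)) (at t within {t0..T})"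
      by (rule rodrigues_compose_derivative[OF e]) (auto intro!: derivative_eq_intros f[OF t])
    from bounded_bilinear.has_vector_derivative[OF bounded_bilinear_matrix_mult dRh[OF t] this]
    have d: "(?R \<epsilon> has_vector_derivative
        Rh t ** ((\<epsilon> * f' t) *\<^sub>R (skew e ** ?Q \<epsilon> t)) + Rh t ** skew (\<Omega>h t) ** ?Q \<epsilon> t) (at t within {t0..T})" .
    \<comment> \<open>Conjugating \<open>skew (\<Omega>h t)\<close> leaves a product Q Q^T next to
      \<open>Rh t\<close>, which cancels.\<close>
    have "?R \<epsilon> t ** skew (?\<Omega> \<epsilon> t) =
        Rh t ** (?Q \<epsilon> t ** transpose (?Q \<epsilon> t)) ** skew (\<Omega>h t) ** ?Q \<epsilon> t
        + (\<epsilon> * f' t) *\<^sub>R (Rh t ** (?Q \<epsilon> t ** skew e))"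
      by (simp add: skew_add skew_rotate[OF r] skew_scaleR matrix_mult.add_right matrix_mult.scaleR_right matrix_mul_assoc
          del: transpose_matrix_vector)
    also have "\<dots> = Rh t ** ((\<epsilon> * f' t) *\<^sub>R (skew e ** ?Q \<epsilon> t)) + Rh t ** skew (\<Omega>h t) ** ?Q \<epsilon> t"
      by (simp add: QQ matrix_mult.scaleR_right skew_rodrigues_commute)
    finally show "(?R \<epsilon> has_vector_derivative ?R \<epsilon> t ** skew (?\<Omega> \<epsilon> t)) (at t within {t0..T})"
      using d by simp
  next
    show "continuous_on {t0..T} (?\<Omega> \<epsilon>)"
      unfolding rodrigues_def
      by (intro continuous_intros continuous_on_matrix_vector_mult continuous_on_transpose c\<Omega> cf f')
  qed
  have snd: "continuous_on ?X (\<lambda>x. h (snd x))"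
    if "continuous_on {t0..T} h" for h :: "real \<Rightarrow> 'z::topological_space"
    by (rule continuous_on_compose2[OF that continuous_on_snd[OF continuous_on_id]]) auto
  note cs = continuous_intros continuous_on_matrix_vector_mult continuous_on_matrix_mult
    continuous_on_transpose snd[OF c\<Omega>] snd[OF cf] snd[OF f'] snd[OF cRh]
  have "continuous_on ?X (\<lambda>(\<epsilon>, t). ?R \<epsilon> t)" "continuous_on ?X (\<lambda>(\<epsilon>, t). ?\<Omega> \<epsilon> t)"
    "continuous_on ?X (\<lambda>(\<epsilon>, t). ?dR \<epsilon> t)" "continuous_on ?X (\<lambda>(\<epsilon>, t). ?d\<Omega> \<epsilon> t)"
    unfolding rodrigues_def case_prod_beta by (intro cs)+
  moreover have "((\<lambda>\<epsilon>. ?R \<epsilon> t) has_vector_derivative Rh t ** skew (f t *\<^sub>R e)) (at 0)" for t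
    using dR[of t 0] by (simp add: skew_scaleR)
  ultimately show ?thesis
    unfolding attitude_variation_def using curve dR d\<Omega> ends
    by (intro conjI exI[of _ "1::real"] exI[of _ ?dR] exI[of _ ?d\<Omega>]) auto
qed

section \<open>The Euler--Lagrange equation\<close>

text \<open>Continuity of the signals makes \<omega> continuous but not differentiable, so the
  existence of its derivative belongs to the right-hand side of the equivalence.\<close>

lemma lagrange_dalembert_iff:
  fixes E :: "real^'n^3" and W :: "real^'n^'n"
  assumes "t0 < T"
    and Um: "continuous_on {t0..T} Um" and \<Omega>m: "continuous_on {t0..T} \<Omega>m"
    and \<beta>h: "continuous_on {t0..T} \<beta>h"
    and W: "pos_def_matrix W" "transpose W = W"
    and \<Phi>: "potential_shape \<Phi> \<Phi>'"
    and c: "attitude_curve t0 T Rh \<Omega>h"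
  defines "\<omega> \<equiv> \<lambda>t. \<Omega>m t - \<Omega>h t - \<beta>h t"
  shows "lagrange_dalembert m D \<Phi> E W Um \<Omega>m \<beta>h t0 T Rh \<Omega>h \<longleftrightarrow>
    (\<forall>t\<in>{t0..T}. ((\<lambda>t. m *\<^sub>R \<omega> t) has_vector_derivative
       - (m *\<^sub>R cross3 (\<Omega>h t) (\<omega> t)
          - \<Phi>' (U0 E W (Rh t) (Um t)) *\<^sub>R S_L (E ** W ** transpose (Um t)) (Rh t) + D *v \<omega> t))
       (at t within {t0..T}))"
proof -
  define q where "q t = m *\<^sub>R cross3 (\<Omega>h t) (\<omega> t)
      - \<Phi>' (U0 E W (Rh t) (Um t)) *\<^sub>R S_L (E ** W ** transpose (Um t)) (Rh t) + D *v \<omega> t" for t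
  have c\<Omega>: "continuous_on {t0..T} \<Omega>h"
    using c by (auto simp: attitude_curve_def)
  have cRh: "continuous_on {t0..T} Rh"
    using c by (auto simp: attitude_curve_def intro: continuous_on_vector_derivative)
  have c\<omega>: "continuous_on {t0..T} \<omega>"
    unfolding \<omega>_def by (intro continuous_intros c\<Omega> \<Omega>m \<beta>h)
  have "continuous_on {t0..T} (\<lambda>t. \<Phi>' (U0 E W (Rh t) (Um t)))"
    by (rule continuous_on_compose2[OF potential_shapeD(3)[OF \<Phi>] continuous_on_U0[OF cRh Um]])
      (use U0_nonneg[OF W(1)] in auto)
  then have cq: "continuous_on {t0..T} q"
    unfolding q_def
    by (intro continuous_intros continuous_on_cross c\<Omega> c\<omega> Um cRh continuous_on_S_L
        continuous_on_matrix_mult continuous_on_matrix_vector_mult continuous_on_transpose)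
  \<comment> \<open>The total virtual work of any variation as a single integral; both directions
    start from it.\<close>
  have key: "\<exists>\<Sigma>' \<delta>S. (\<forall>t\<in>{t0..T}. (\<Sigma> has_vector_derivative \<Sigma>' t) (at t within {t0..T})) \<and>
      \<Sigma> t0 = 0 \<and> \<Sigma> T = 0 \<and>
      ((\<lambda>\<epsilon>. action m \<Phi> E W Um \<Omega>m \<beta>h t0 T (Rv \<epsilon>) (\<Omega>v \<epsilon>)) has_real_derivative \<delta>S) (at 0) \<and>
      \<delta>S + integral {t0..T} (\<lambda>s. (D *v \<omega> s) \<bullet> \<Sigma> s) =
        integral {t0..T} (\<lambda>s. q s \<bullet> \<Sigma> s - m * (\<omega> s \<bullet> \<Sigma>' s))"
    if v: "attitude_variation t0 T Rh Rv \<Omega>v \<Sigma>" for Rv \<Omega>v \<Sigma>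
  proof -
    obtain \<Sigma>' where d\<Sigma>: "\<And>t. t \<in> {t0..T} \<Longrightarrow> (\<Sigma> has_vector_derivative \<Sigma>' t) (at t within {t0..T})"
      and ends: "\<Sigma> t0 = 0" "\<Sigma> T = 0"
      and act: "((\<lambda>\<epsilon>. action m \<Phi> E W Um \<Omega>m \<beta>h t0 T (Rv \<epsilon>) (\<Omega>v \<epsilon>)) has_real_derivative
        integral {t0..T} (\<lambda>s. - m * (\<omega> s \<bullet> (\<Sigma>' s + cross3 (\<Omega>h s) (\<Sigma> s)))
          - \<Phi>' (U0 E W (Rh s) (Um s)) * (S_L (E ** W ** transpose (Um s)) (Rh s) \<bullet> \<Sigma> s))) (at 0)"
      and int: "(\<lambda>s. - m * (\<omega> s \<bullet> (\<Sigma>' s + cross3 (\<Omega>h s) (\<Sigma> s)))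
          - \<Phi>' (U0 E W (Rh s) (Um s)) * (S_L (E ** W ** transpose (Um s)) (Rh s) \<bullet> \<Sigma> s)) integrable_on {t0..T}"
      by (rule action_has_derivative[OF assms(1) Um \<Omega>m \<beta>h W \<Phi> c v, of m])
        (rule that[unfolded \<omega>_def])
    have c\<Sigma>: "continuous_on {t0..T} \<Sigma>"
      using d\<Sigma> by (rule continuous_on_vector_derivative)
    have "(\<lambda>s. (D *v \<omega> s) \<bullet> \<Sigma> s) integrable_on {t0..T}"
      by (intro integrable_continuous_real continuous_intros continuous_on_matrix_vector_mult c\<Sigma> c\<omega>)
    from integral_add[OF int this] act d\<Sigma> ends show ?thesis
      unfolding virtual_work_integrand_eq q_def[symmetric] by (intro exI[of _ \<Sigma>'] exI) auto
  qed
  have "lagrange_dalembert m D \<Phi> E W Um \<Omega>m \<beta>h t0 T Rh \<Omega>h \<longleftrightarrow>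
    (\<forall>t\<in>{t0..T}. ((\<lambda>t. m *\<^sub>R \<omega> t) has_vector_derivative - q t) (at t within {t0..T}))" (is "?L \<longleftrightarrow> ?E")
  proof
    assume ?E
    show ?L
      unfolding lagrange_dalembert_def
    proof (intro conjI c allI impI)
      fix Rv \<Omega>v \<Sigma>
      assume "attitude_variation t0 T Rh Rv \<Omega>v \<Sigma>"
      from key[OF this] obtain \<Sigma>' \<delta>S
        where d\<Sigma>: "\<forall>t\<in>{t0..T}. (\<Sigma> has_vector_derivative \<Sigma>' t) (at t within {t0..T})"
          and ends: "\<Sigma> t0 = 0" "\<Sigma> T = 0"
          and act: "((\<lambda>\<epsilon>. action m \<Phi> E W Um \<Omega>m \<beta>h t0 T (Rv \<epsilon>) (\<Omega>v \<epsilon>)) has_real_derivative \<delta>S) (at 0)"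
          and eq: "\<delta>S + integral {t0..T} (\<lambda>s. (D *v \<omega> s) \<bullet> \<Sigma> s) =
            integral {t0..T} (\<lambda>s. q s \<bullet> \<Sigma> s - m * (\<omega> s \<bullet> \<Sigma>' s))"
        by blast
      \<comment> \<open>By the equation of motion this derivative is the negative of the integrand
        in \<open>key\<close>, and the boundary terms vanish with \<Sigma>.\<close>
      have "((\<lambda>s. (m *\<^sub>R \<omega> s) \<bullet> \<Sigma> s) has_vector_derivative
          (m *\<^sub>R \<omega> s) \<bullet> \<Sigma>' s + (- q s) \<bullet> \<Sigma> s) (at s within {t0..T})" if "s \<in> {t0..T}" for s
        using \<open>?E\<close> d\<Sigma> that
        by (intro bounded_bilinear.has_vector_derivative[OF bounded_bilinear_inner]) auto
      then have "((\<lambda>s. (m *\<^sub>R \<omega> s) \<bullet> \<Sigma>' s + (- q s) \<bullet> \<Sigma> s) has_integral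
          (m *\<^sub>R \<omega> T) \<bullet> \<Sigma> T - (m *\<^sub>R \<omega> t0) \<bullet> \<Sigma> t0) {t0..T}"
        using assms(1) by (intro fundamental_theorem_of_calculus) auto
      from has_integral_neg[OF this] have "integral {t0..T} (\<lambda>s. q s \<bullet> \<Sigma> s - m * (\<omega> s \<bullet> \<Sigma>' s)) = 0"
        by (simp add: ends integral_unique)
      with eq act show "\<exists>\<delta>S. ((\<lambda>\<epsilon>. action m \<Phi> E W Um \<Omega>m \<beta>h t0 T (Rv \<epsilon>) (\<Omega>v \<epsilon>)) has_real_derivative \<delta>S) (at 0) \<and>
          \<delta>S + integral {t0..T} (\<lambda>s. (D *v (\<Omega>m s - \<Omega>h s - \<beta>h s)) \<bullet> \<Sigma> s) = 0"
        by (auto simp: \<omega>_def)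
    qed
  next
    assume ?L
    \<comment> \<open>Each scalar test function f gives the rotation by the angle \<epsilon> f about
      e, so projection on the axis e reduces the vector equation to the scalar lemma.\<close>
    have comp: "((\<lambda>t. (m *\<^sub>R \<omega> t) \<bullet> e) has_real_derivative - (q t \<bullet> e)) (at t within {t0..T})"
      if e: "norm e = 1" and t: "t \<in> {t0..T}" for e t
    proof (rule du_bois_reymond[where p = "\<lambda>t. (m *\<^sub>R \<omega> t) \<bullet> e" and q = "\<lambda>t. q t \<bullet> e", OF assms(1) _ _ _ t])
      show "continuous_on {t0..T} (\<lambda>t. (m *\<^sub>R \<omega> t) \<bullet> e)" "continuous_on {t0..T} (\<lambda>t. q t \<bullet> e)"
        by (intro continuous_intros c\<omega> cq)+
      fix f f' :: "real \<Rightarrow> real"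
      assume f: "\<And>t. t \<in> {t0..T} \<Longrightarrow> (f has_real_derivative f' t) (at t within {t0..T})"
        and f': "continuous_on {t0..T} f'" "f t0 = 0" "f T = 0"
      note v = rotated_curve_variation[OF c e f f']
      from key[OF v] obtain \<Sigma>' \<delta>S
        where d\<Sigma>: "\<forall>t\<in>{t0..T}. ((\<lambda>t. f t *\<^sub>R e) has_vector_derivative \<Sigma>' t) (at t within {t0..T})"
          and act: "((\<lambda>\<epsilon>. action m \<Phi> E W Um \<Omega>m \<beta>h t0 T (\<lambda>t. Rh t ** rodrigues e (\<epsilon> * f t))
            (\<lambda>t. transpose (rodrigues e (\<epsilon> * f t)) *v \<Omega>h t + (\<epsilon> * f' t) *\<^sub>R e)) has_real_derivative \<delta>S) (at 0)"
          and eq: "\<delta>S + integral {t0..T} (\<lambda>s. (D *v \<omega> s) \<bullet> (f s *\<^sub>R e)) =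
            integral {t0..T} (\<lambda>s. q s \<bullet> (f s *\<^sub>R e) - m * (\<omega> s \<bullet> \<Sigma>' s))"
        by blast
      \<comment> \<open>\<open>key\<close> provides some derivative of f e; uniqueness on the
        nondegenerate interval identifies it as f' e.\<close>
      have \<Sigma>': "\<Sigma>' s = f' s *\<^sub>R e" if s: "s \<in> {t0..T}" for s
      proof (rule vector_derivative_unique_within_closed_interval[OF assms(1), of s])
        show "((\<lambda>t. f t *\<^sub>R e) has_vector_derivative \<Sigma>' s) (at s within cbox t0 T)"
          using d\<Sigma> s by (simp add: cbox_interval)
        show "((\<lambda>t. f t *\<^sub>R e) has_vector_derivative f' s *\<^sub>R e) (at s within cbox t0 T)"
          using f[OF s] unfolding has_real_derivative_iff_has_vector_derivative cbox_interval
          by (rule bounded_linear.has_vector_derivative[OF bounded_linear_scaleR_left])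
      qed (use s in \<open>simp add: cbox_interval\<close>)
      obtain \<delta>S' where act': "((\<lambda>\<epsilon>. action m \<Phi> E W Um \<Omega>m \<beta>h t0 T (\<lambda>t. Rh t ** rodrigues e (\<epsilon> * f t))
            (\<lambda>t. transpose (rodrigues e (\<epsilon> * f t)) *v \<Omega>h t + (\<epsilon> * f' t) *\<^sub>R e)) has_real_derivative \<delta>S') (at 0)"
          and eq': "\<delta>S' + integral {t0..T} (\<lambda>s. (D *v \<omega> s) \<bullet> (f s *\<^sub>R e)) = 0"
        using \<open>?L\<close> v unfolding lagrange_dalembert_def \<omega>_def by blast
      have "integral {t0..T} (\<lambda>s. q s \<bullet> (f s *\<^sub>R e) - m * (\<omega> s \<bullet> \<Sigma>' s)) = 0"
        using eq eq' unfolding DERIV_unique[OF act act'] by simp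
      moreover have "integral {t0..T} (\<lambda>s. q s \<bullet> (f s *\<^sub>R e) - m * (\<omega> s \<bullet> \<Sigma>' s)) =
          integral {t0..T} (\<lambda>t. q t \<bullet> e * f t - (m *\<^sub>R \<omega> t) \<bullet> e * f' t)"
        by (rule integral_cong) (simp add: \<Sigma>' mult_ac)
      ultimately show "integral {t0..T} (\<lambda>t. q t \<bullet> e * f t - (m *\<^sub>R \<omega> t) \<bullet> e * f' t) = 0"
        by simp
    qed
    show ?E
      unfolding has_vector_derivative_def has_derivative_componentwise_within[of "\<lambda>t. m *\<^sub>R \<omega> t"]
    proof (intro ballI)
      fix t :: real and i :: "real^3"
      assume t: "t \<in> {t0..T}" and "i \<in> Basis"
      have "(*) (- (q t \<bullet> i)) = (\<lambda>x. (x *\<^sub>R - q t) \<bullet> i)"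
        by auto
      then show "((\<lambda>t. (m *\<^sub>R \<omega> t) \<bullet> i) has_derivative (\<lambda>x. (x *\<^sub>R - q t) \<bullet> i)) (at t within {t0..T})"
        using comp[OF _ t, of i] \<open>i \<in> Basis\<close> by (simp only: has_field_derivative_def norm_Basis)
    qed
  qed
  then show ?thesis
    unfolding q_def .
qed

section \<open>The variational principle and the filter equations with initial data\<close>

theorem theorem6p1:
  fixes m t0 T :: real
    and D :: "real^3^3"
    and E :: "real^'n^3" and W :: "real^'n^'n"
    and \<Phi> \<Phi>' :: "real \<Rightarrow> real"
    and R :: "real \<Rightarrow> real^3^3" and \<Omega> :: "real \<Rightarrow> real^3"
    and N Um :: "real \<Rightarrow> real^'n^3"
    and w \<Omega>m :: "real \<Rightarrow> real^3" and \<beta> :: "real^3"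
    and Rh :: "real \<Rightarrow> real^3^3" and \<Omega>h \<beta>h \<omega> :: "real \<Rightarrow> real^3"
    and Rh0 :: "real^3^3" and \<Omega>m0 \<Omega>h0 \<beta>h0 \<omega>0 :: "real^3"
  assumes "t0 < T"
    and "\<forall>t\<in>{t0..T}. rotation_matrix (R t) \<and>
           (R has_vector_derivative R t ** skew (\<Omega> t)) (at t within {t0..T})"
    and "\<forall>t\<in>{t0..T}. Um t = transpose (R t) ** E + N t"
    and "\<forall>t\<in>{t0..T}. \<Omega>m t = \<Omega> t + w t + \<beta>"
    and "continuous_on {t0..T} Um"
    and "continuous_on {t0..T} \<Omega>m"
    and "continuous_on {t0..T} \<beta>h"
    and "rank E = 3"
    and "pos_def_matrix W"
    and "weight_condition E W"
    and "0 < m"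
    and "pos_def_matrix D"
    and "potential_shape \<Phi> \<Phi>'"
    and "\<forall>t\<in>{t0..T}. rotation_matrix (Rh t)"
    and "\<Omega>m0 = \<Omega>m t0"
    and "\<beta>h0 = \<beta>h t0"
    and "\<omega>0 = \<Omega>m0 - \<Omega>h0 - \<beta>h0"
  shows
    "(lagrange_dalembert m D \<Phi> E W Um \<Omega>m \<beta>h t0 T Rh \<Omega>h \<and>
      (\<forall>t\<in>{t0..T}. \<omega> t = \<Omega>m t - \<Omega>h t - \<beta>h t) \<and>
      Rh t0 = Rh0 \<and> \<Omega>h t0 = \<Omega>h0)
     \<longleftrightarrow>
     ((\<forall>t\<in>{t0..T}.
         (Rh has_vector_derivative Rh t ** skew (\<Omega>h t)) (at t within {t0..T}) \<and>
         Rh t ** skew (\<Omega>h t) = Rh t ** skew (\<Omega>m t - \<omega> t - \<beta>h t) \<and>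
         (\<exists>d\<omega>. (\<omega> has_vector_derivative d\<omega>) (at t within {t0..T}) \<and>
            m *\<^sub>R d\<omega> = - (m *\<^sub>R cross3 (\<Omega>h t) (\<omega> t))
                       + \<Phi>' (U0 E W (Rh t) (Um t)) *\<^sub>R S_L (E ** W ** transpose (Um t)) (Rh t)
                       - D *v \<omega> t) \<and>
         \<Omega>h t = \<Omega>m t - \<omega> t - \<beta>h t) \<and>
      Rh t0 = Rh0 \<and> \<omega> t0 = \<omega>0)"
proof -
  note Um = assms(5) and \<Omega>m = assms(6) and \<beta>h = assms(7) and W = assms(9) weight_condition_symmetric[OF assms(10)]
  define q where "q t = m *\<^sub>R cross3 (\<Omega>h t) (\<omega> t)
      - \<Phi>' (U0 E W (Rh t) (Um t)) *\<^sub>R S_L (E ** W ** transpose (Um t)) (Rh t) + D *v \<omega> t" for t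
  \<comment> \<open>In the theorem \<omega> is a function of its own that agrees with the residual
    only on the time interval; derivatives within that interval transfer between the two.\<close>
  have LD: "lagrange_dalembert m D \<Phi> E W Um \<Omega>m \<beta>h t0 T Rh \<Omega>h \<longleftrightarrow>
      (\<forall>t\<in>{t0..T}. ((\<lambda>t. m *\<^sub>R \<omega> t) has_vector_derivative - q t) (at t within {t0..T}))"
    if c: "attitude_curve t0 T Rh \<Omega>h" and \<omega>: "\<forall>t\<in>{t0..T}. \<omega> t = \<Omega>m t - \<Omega>h t - \<beta>h t"
  proof -
    have "((\<lambda>t. m *\<^sub>R (\<Omega>m t - \<Omega>h t - \<beta>h t)) has_vector_derivative d) (at t within {t0..T}) \<longleftrightarrow>
        ((\<lambda>t. m *\<^sub>R \<omega> t) has_vector_derivative d) (at t within {t0..T})" if "t \<in> {t0..T}" for t d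
      by (rule iffI; rule has_vector_derivative_transform[OF that]) (use \<omega> in auto)
    then show ?thesis
      unfolding lagrange_dalembert_iff[OF assms(1) Um \<Omega>m \<beta>h W assms(13) c] q_def
      using \<omega> by (intro ball_cong) simp_all
  qed
  \<comment> \<open>Division by m > 0 passes from the momentum m \<omega> to \<omega>.\<close>
  have scaled: "((\<lambda>t. m *\<^sub>R \<omega> t) has_vector_derivative - q t) (at t within {t0..T}) \<longleftrightarrow>
      (\<exists>d\<omega>. (\<omega> has_vector_derivative d\<omega>) (at t within {t0..T}) \<and>
         m *\<^sub>R d\<omega> = - (m *\<^sub>R cross3 (\<Omega>h t) (\<omega> t))
                    + \<Phi>' (U0 E W (Rh t) (Um t)) *\<^sub>R S_L (E ** W ** transpose (Um t)) (Rh t)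
                    - D *v \<omega> t)" (is "?l \<longleftrightarrow> ?r") for t
  proof
    assume ?l
    from bounded_linear.has_vector_derivative[OF bounded_linear_scaleR_right this, of "1 / m"]
    have "(\<omega> has_vector_derivative (1 / m) *\<^sub>R - q t) (at t within {t0..T})"
      using assms(11) by simp
    with assms(11) show ?r
      by (intro exI[of _ "(1 / m) *\<^sub>R - q t"]) (auto simp: q_def)
  next
    assume ?r
    then obtain d where d: "(\<omega> has_vector_derivative d) (at t within {t0..T})" and "m *\<^sub>R d = - q t"
      by (auto simp: q_def)
    then show ?l
      using bounded_linear.has_vector_derivative[OF bounded_linear_scaleR_right d, of m] by simp
  qed
  show ?thesis (is "?L \<longleftrightarrow> ?R")
  proof
    assume ?L
    then have c: "attitude_curve t0 T Rh \<Omega>h" and \<omega>: "\<forall>t\<in>{t0..T}. \<omega> t = \<Omega>m t - \<Omega>h t - \<beta>h t"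
      by (auto simp: lagrange_dalembert_def)
    have "\<forall>t\<in>{t0..T}. (Rh has_vector_derivative Rh t ** skew (\<Omega>h t)) (at t within {t0..T})"
      using c by (auto simp: attitude_curve_def)
    moreover have "\<forall>t\<in>{t0..T}. \<Omega>h t = \<Omega>m t - \<omega> t - \<beta>h t"
      using \<omega> by simp
    moreover from this have "\<forall>t\<in>{t0..T}. Rh t ** skew (\<Omega>h t) = Rh t ** skew (\<Omega>m t - \<omega> t - \<beta>h t)"
      by metis
    moreover have "\<forall>t\<in>{t0..T}. ((\<lambda>t. m *\<^sub>R \<omega> t) has_vector_derivative - q t) (at t within {t0..T})"
      using \<open>?L\<close> LD[OF c \<omega>] by blast
    moreover have "\<omega> t0 = \<omega>0"
      using \<omega> \<open>?L\<close> assms(1) by (simp add: assms(15-17))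
    moreover have "Rh t0 = Rh0"
      using \<open>?L\<close> by blast
    ultimately show ?R
      unfolding scaled by blast
  next
    assume ?R
    then have eqs: "\<forall>t\<in>{t0..T}. ((\<lambda>t. m *\<^sub>R \<omega> t) has_vector_derivative - q t) (at t within {t0..T})"
      and "\<forall>t\<in>{t0..T}. \<Omega>h t = \<Omega>m t - \<omega> t - \<beta>h t"
      unfolding scaled by blast+
    then have \<omega>: "\<forall>t\<in>{t0..T}. \<omega> t = \<Omega>m t - \<Omega>h t - \<beta>h t"
      by simp
    \<comment> \<open>\<open>attitude_curve\<close> asks for a continuous velocity. In this
      direction it comes from the differentiability of \<omega> and the algebraic relation between
      \<open>\<Omega>h\<close>, \<omega> and the continuous signals.\<close>
    have "continuous_on {t0..T} \<omega>"
      unfolding continuous_on_eq_continuous_within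
      using \<open>?R\<close> has_vector_derivative_continuous by blast
    then have "continuous_on {t0..T} (\<lambda>t. \<Omega>m t - \<omega> t - \<beta>h t)"
      by (intro continuous_intros \<Omega>m \<beta>h)
    then have "continuous_on {t0..T} \<Omega>h"
      using \<omega> by (subst continuous_on_cong[OF refl]) auto
    then have c: "attitude_curve t0 T Rh \<Omega>h"
      using \<open>?R\<close> assms(14) unfolding attitude_curve_def by blast
    \<comment> \<open>The same relation at the initial time turns the datum for \<omega> into the
      one for \<open>\<Omega>h\<close>.\<close>
    have "\<Omega>h t0 = \<Omega>m t0 - \<omega>0 - \<beta>h t0"
      using \<open>?R\<close> assms(1) by (metis atLeastAtMost_iff less_imp_le order_refl)
    then have "\<Omega>h t0 = \<Omega>h0"
      by (simp add: assms(15-17))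
    with \<open>?R\<close> \<omega> eqs show ?L
      using LD[OF c \<omega>] by blast
  qed
qed

end
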